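(* Let $f\colon A\to B$ be a morphism of MV-algebras. The commutative square with sides $\eta_A\colon A\to S(A)=A/\mathrm{Rad}(A)$, $S(f)\colon S(A)\to S(B)$, $f\colon A\to B$ and $\eta_B\colon B\to S(B)=B/\mathrm{Rad}(B)$ (so $S(f)\,\eta_A=\eta_B\,f$) is a pullback in $\mathbb{MV}$ (i.e. $f$ is a trivial extension for the Galois structure $\Gamma$) if and only if $P(f)\colon P(A)\to P(B)$ is an isomorphism, or $P(A)=\mathbf{2}$ and $P(B)=\mathbf{1}$.
   Context: An MV-algebra is a set $A$ with a binary operation $\oplus$, a unary operation $\lnot$ and a constant $0$ such that $\oplus$ is associative and commutative, $x\oplus 0=x$, $\lnot\lnot x=x$, $x\oplus\lnot 0=\lnot 0$, and $\lnot(\lnot x\oplus y)\oplus y=\lnot(\lnot y\oplus x)\oplus x$. Morphisms are the maps preserving $\oplus,\lnot,0$; $\mathbb{MV}$ is the resulting category. Its terminal object $\mathbf{1}$ is the one-element algebra and its initial object $\mathbf{2}$ is the algebra $\{0,1\}$ (equalities with $\mathbf{1}$, $\mathbf{2}$ are up to isomorphism). Put $1=\lnot 0$, $x\ominus y=\lnot(\lnot x\oplus y)$, $d(x,y)=(x\ominus y)\oplus(y\ominus x)$, and $x\le y$ iff $\lnot x\oplus y=1$. An ideal of $A$ is a subset $I\subseteq A$ containing $0$, closed under $\oplus$, and such that $x\in I$ and $y\le x$ imply $y\in I$; it is proper if $I\ne A$. For an ideal $I$, $A/I$ is the quotient of $A$ by the congruence $x\sim y\iff d(x,y)\in I$. $\mathrm{Rad}(A)$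 is the intersection of all maximal (proper) ideals of $A$ (with $\mathrm{Rad}(A)=A=\{0\}$ if $A=\mathbf{1}$). For $T\subseteq A$, $\lnot T=\{x\in A\mid\lnot x\in T\}$. $P(A)=\mathrm{Rad}(A)\cup\lnot\mathrm{Rad}(A)$ is a subalgebra of $A$, and $P(f)\colon P(A)\to P(B)$ is the restriction of $f$. $S(A)=A/\mathrm{Rad}(A)$, $S(f)([a])=[f(a)]$, and $\eta_A\colon A\to S(A)$ is the quotient projection. $\Gamma$ denotes the Galois structure given by the adjunction between $S\colon\mathbb{MV}\to s\mathbb{MV}$ and the inclusion $i\colon s\mathbb{MV}\hookrightarrow\mathbb{MV}$ of the full subcategory of semisimple MV-algebras (those with $\mathrm{Rad}(A)=\{0\}$), relatively to the classes of all arrows; a trivial extension for $\Gamma$ is an arrow $f$ for which the square described in the claim is a pullback. *)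

theory Defs
  imports Main "HOL-Library.FuncSet"
begin

record 'a mv =
  carrier :: "'a set"
  oplus :: "'a \<Rightarrow> 'a \<Rightarrow> 'a" (infixl "\<oplus>\<index>" 65)
  neg :: "'a \<Rightarrow> 'a" ("\<sim>\<index> _" [81] 80)
  zero :: 'a ("\<zero>\<index>")

locale mv_algebra =
  fixes A :: "'a mv" (structure)
  assumes oplus_closed: "\<lbrakk>x \<in> carrier A; y \<in> carrier A\<rbrakk> \<Longrightarrow> x \<oplus> y \<in> carrier A"
    and neg_closed: "x \<in> carrier A \<Longrightarrow> \<sim> x \<in> carrier A"
    and zero_closed: "\<zero> \<in> carrier A"
    and oplus_assoc:
      "\<lbrakk>x \<in> carrier A; y \<in> carrier A; z \<in> carrier A\<rbrakk> \<Longrightarrow> (x \<oplus> y) \<oplus> z = x \<oplus> (y \<oplus> z)"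
    and oplus_comm: "\<lbrakk>x \<in> carrier A; y \<in> carrier A\<rbrakk> \<Longrightarrow> x \<oplus> y = y \<oplus> x"
    and oplus_zero: "x \<in> carrier A \<Longrightarrow> x \<oplus> \<zero> = x"
    and neg_neg: "x \<in> carrier A \<Longrightarrow> \<sim> (\<sim> x) = x"
    and oplus_neg_zero: "x \<in> carrier A \<Longrightarrow> x \<oplus> \<sim> \<zero> = \<sim> \<zero>"
    and lukasiewicz:
      "\<lbrakk>x \<in> carrier A; y \<in> carrier A\<rbrakk> \<Longrightarrow> \<sim> (\<sim> x \<oplus> y) \<oplus> y = \<sim> (\<sim> y \<oplus> x) \<oplus> x"

text \<open>Morphisms are represented by functions whose values outside the carrier are irrelevant;
  two of them are the same morphism iff they agree on the carrier.\<close>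

definition mv_hom :: "'a mv \<Rightarrow> 'b mv \<Rightarrow> ('a \<Rightarrow> 'b) set" where
  "mv_hom A B = {h \<in> carrier A \<rightarrow> carrier B.
     (\<forall>x\<in>carrier A. \<forall>y\<in>carrier A. h (x \<oplus>\<^bsub>A\<^esub> y) = h x \<oplus>\<^bsub>B\<^esub> h y) \<and>
     (\<forall>x\<in>carrier A. h (\<sim>\<^bsub>A\<^esub> x) = \<sim>\<^bsub>B\<^esub> (h x)) \<and>
     h \<zero>\<^bsub>A\<^esub> = \<zero>\<^bsub>B\<^esub>}"

lemma mv_hom_comp:
  assumes "u \<in> mv_hom Q M" and "v \<in> mv_hom M R"
  shows "(\<lambda>c. v (u c)) \<in> mv_hom Q R"
  using assms by (auto simp: mv_hom_def Pi_iff)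

definition mv_isomorphism :: "'a mv \<Rightarrow> 'b mv \<Rightarrow> ('a \<Rightarrow> 'b) \<Rightarrow> bool" where
  "mv_isomorphism A B h \<longleftrightarrow> h \<in> mv_hom A B \<and>
     (\<exists>g\<in>mv_hom B A. (\<forall>x\<in>carrier A. g (h x) = x) \<and> (\<forall>y\<in>carrier B. h (g y) = y))"

definition mv_isomorphic :: "'a mv \<Rightarrow> 'b mv \<Rightarrow> bool" (infix "\<cong>" 50) where
  "A \<cong> B \<longleftrightarrow> (\<exists>h. mv_isomorphism A B h)"

definition mv_terminal :: "unit mv" where
  "mv_terminal = \<lparr>carrier = UNIV, oplus = (\<lambda>_ _. ()), neg = (\<lambda>_. ()), zero = ()\<rparr>"

definition mv_initial :: "bool mv" where
  "mv_initial = \<lparr>carrier = UNIV, oplus = (\<or>), neg = Not, zero = False\<rparr>"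

definition mv_one :: "'a mv \<Rightarrow> 'a" ("\<one>\<index>") where
  "\<one>\<^bsub>A\<^esub> = \<sim>\<^bsub>A\<^esub> \<zero>\<^bsub>A\<^esub>"

definition mv_minus :: "'a mv \<Rightarrow> 'a \<Rightarrow> 'a \<Rightarrow> 'a" (infixl "\<ominus>\<index>" 65) where
  "x \<ominus>\<^bsub>A\<^esub> y = \<sim>\<^bsub>A\<^esub> (\<sim>\<^bsub>A\<^esub> x \<oplus>\<^bsub>A\<^esub> y)"

definition mv_dist :: "'a mv \<Rightarrow> 'a \<Rightarrow> 'a \<Rightarrow> 'a" where
  "mv_dist A x y = (x \<ominus>\<^bsub>A\<^esub> y) \<oplus>\<^bsub>A\<^esub> (y \<ominus>\<^bsub>A\<^esub> x)"

definition mv_le :: "'a mv \<Rightarrow> 'a \<Rightarrow> 'a \<Rightarrow> bool" (infix "\<sqsubseteq>\<index>" 50) where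
  "x \<sqsubseteq>\<^bsub>A\<^esub> y \<longleftrightarrow> \<sim>\<^bsub>A\<^esub> x \<oplus>\<^bsub>A\<^esub> y = \<one>\<^bsub>A\<^esub>"

definition mv_ideal :: "'a mv \<Rightarrow> 'a set \<Rightarrow> bool" where
  "mv_ideal A I \<longleftrightarrow> I \<subseteq> carrier A \<and> \<zero>\<^bsub>A\<^esub> \<in> I \<and>
     (\<forall>x\<in>I. \<forall>y\<in>I. x \<oplus>\<^bsub>A\<^esub> y \<in> I) \<and>
     (\<forall>x\<in>I. \<forall>y\<in>carrier A. y \<sqsubseteq>\<^bsub>A\<^esub> x \<longrightarrow> y \<in> I)"

definition mv_maximal_ideal :: "'a mv \<Rightarrow> 'a set \<Rightarrow> bool" where
  "mv_maximal_ideal A M \<longleftrightarrow> mv_ideal A M \<and> M \<noteq> carrier A \<and>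
     (\<forall>I. mv_ideal A I \<and> I \<noteq> carrier A \<and> M \<subseteq> I \<longrightarrow> I = M)"

text \<open>The one-element algebra has no maximal ideals, so its radical is the whole algebra.\<close>

definition Rad :: "'a mv \<Rightarrow> 'a set" where
  "Rad A = {x \<in> carrier A. \<forall>M. mv_maximal_ideal A M \<longrightarrow> x \<in> M}"

definition mv_neg_set :: "'a mv \<Rightarrow> 'a set \<Rightarrow> 'a set" where
  "mv_neg_set A T = {x \<in> carrier A. \<sim>\<^bsub>A\<^esub> x \<in> T}"

definition P_obj :: "'a mv \<Rightarrow> 'a mv" where
  "P_obj A = A\<lparr>carrier := Rad A \<union> mv_neg_set A (Rad A)\<rparr>"

definition P_map :: "'a mv \<Rightarrow> ('a \<Rightarrow> 'b) \<Rightarrow> 'a \<Rightarrow> 'b" where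
  "P_map A f = restrict f (carrier (P_obj A))"

definition mv_cong :: "'a mv \<Rightarrow> 'a set \<Rightarrow> ('a \<times> 'a) set" where
  "mv_cong A I = {(x, y). x \<in> carrier A \<and> y \<in> carrier A \<and> mv_dist A x y \<in> I}"

text \<open>On congruence classes \<open>X\<close>, \<open>Y\<close> all members of each union below (and of the one in
  \<open>S_map\<close>) coincide, so that the union is the class of the value on representatives.\<close>

definition mv_quotient :: "'a mv \<Rightarrow> 'a set \<Rightarrow> 'a set mv" where
  "mv_quotient A I =
     \<lparr>carrier = carrier A // mv_cong A I,
      oplus = (\<lambda>X Y. \<Union>x\<in>X. \<Union>y\<in>Y. mv_cong A I `` {x \<oplus>\<^bsub>A\<^esub> y}),
      neg = (\<lambda>X. \<Union>x\<in>X. mv_cong A I `` {\<sim>\<^bsub>A\<^esub> x}),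
      zero = mv_cong A I `` {\<zero>\<^bsub>A\<^esub>}\<rparr>"

definition S_obj :: "'a mv \<Rightarrow> 'a set mv" where
  "S_obj A = mv_quotient A (Rad A)"

definition eta :: "'a mv \<Rightarrow> 'a \<Rightarrow> 'a set" where
  "eta A a = mv_cong A (Rad A) `` {a}"

definition S_map :: "'b mv \<Rightarrow> ('a \<Rightarrow> 'b) \<Rightarrow> 'a set \<Rightarrow> 'b set" where
  "S_map B f X = (\<Union>a\<in>X. eta B (f a))"

text \<open>The universal property of the square with \<open>p1 : P \<rightarrow> X\<close>, \<open>p2 : P \<rightarrow> Y\<close>, \<open>g : X \<rightarrow> Z\<close>,
  \<open>h : Y \<rightarrow> Z\<close>, tested against all algebras \<open>Q\<close> whose carrier is a subset of the type \<open>'c\<close>.\<close>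

definition mv_pullback_wrt ::
  "'c itself \<Rightarrow> 'p mv \<Rightarrow> 'x mv \<Rightarrow> 'y mv \<Rightarrow> 'z mv \<Rightarrow>
   ('p \<Rightarrow> 'x) \<Rightarrow> ('p \<Rightarrow> 'y) \<Rightarrow> ('x \<Rightarrow> 'z) \<Rightarrow> ('y \<Rightarrow> 'z) \<Rightarrow> bool" where
  "mv_pullback_wrt (_ :: 'c itself) P X Y Z p1 p2 g h \<longleftrightarrow>
     mv_algebra P \<and> mv_algebra X \<and> mv_algebra Y \<and> mv_algebra Z \<and>
     p1 \<in> mv_hom P X \<and> p2 \<in> mv_hom P Y \<and> g \<in> mv_hom X Z \<and> h \<in> mv_hom Y Z \<and>
     (\<forall>a\<in>carrier P. g (p1 a) = h (p2 a)) \<and>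
     (\<forall>(Q :: 'c mv) q1 q2.
        mv_algebra Q \<and> q1 \<in> mv_hom Q X \<and> q2 \<in> mv_hom Q Y \<and>
        (\<forall>c\<in>carrier Q. g (q1 c) = h (q2 c)) \<longrightarrow>
        (\<exists>u\<in>mv_hom Q P.
           (\<forall>c\<in>carrier Q. p1 (u c) = q1 c \<and> p2 (u c) = q2 c) \<and>
           (\<forall>v\<in>mv_hom Q P.
              (\<forall>c\<in>carrier Q. p1 (v c) = q1 c \<and> p2 (v c) = q2 c) \<longrightarrow>
              (\<forall>c\<in>carrier Q. v c = u c))))"

text \<open>HOL cannot quantify over all types inside a definition. Testing against algebras on
  \<open>'p \<times> 'x \<times> 'y\<close> is enough: this type has room for a copy of \<open>P\<close> and for a copy of the fibre
  product of \<open>X\<close> and \<open>Y\<close>, and the lemma \<open>mv_pullback_universal\<close> below derives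
  the universal property for test algebras on an arbitrary type.\<close>

definition mv_pullback ::
  "'p mv \<Rightarrow> 'x mv \<Rightarrow> 'y mv \<Rightarrow> 'z mv \<Rightarrow>
   ('p \<Rightarrow> 'x) \<Rightarrow> ('p \<Rightarrow> 'y) \<Rightarrow> ('x \<Rightarrow> 'z) \<Rightarrow> ('y \<Rightarrow> 'z) \<Rightarrow> bool" where
  "mv_pullback (P :: 'p mv) (X :: 'x mv) (Y :: 'y mv) Z p1 p2 g h \<longleftrightarrow>
     mv_pullback_wrt TYPE('p \<times> 'x \<times> 'y) P X Y Z p1 p2 g h"

lemma mv_pullback_universal:
  fixes P :: "'p mv" and X :: "'x mv" and Y :: "'y mv" and Z :: "'z mv"
  assumes pb: "mv_pullback P X Y Z p1 p2 g h"
  shows "mv_pullback_wrt TYPE('c) P X Y Z p1 p2 g h"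
proof -
  note pb' = pb[unfolded mv_pullback_def mv_pullback_wrt_def]
  have alg: "mv_algebra P" "mv_algebra X" "mv_algebra Y" "mv_algebra Z"
    and homs: "p1 \<in> mv_hom P X" "p2 \<in> mv_hom P Y" "g \<in> mv_hom X Z" "h \<in> mv_hom Y Z"
    and comm: "\<forall>a\<in>carrier P. g (p1 a) = h (p2 a)"
    using pb' by blast+
  have univ: "\<exists>u\<in>mv_hom Q P.
           (\<forall>c\<in>carrier Q. p1 (u c) = q1 c \<and> p2 (u c) = q2 c) \<and>
           (\<forall>v\<in>mv_hom Q P.
              (\<forall>c\<in>carrier Q. p1 (v c) = q1 c \<and> p2 (v c) = q2 c) \<longrightarrow>
              (\<forall>c\<in>carrier Q. v c = u c))"
    if "mv_algebra Q" "q1 \<in> mv_hom Q X" "q2 \<in> mv_hom Q Y"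
      "\<forall>c\<in>carrier Q. g (q1 c) = h (q2 c)" for Q :: "('p \<times> 'x \<times> 'y) mv" and q1 q2
    using pb' that by blast
  interpret X: mv_algebra X by fact
  interpret Y: mv_algebra Y by fact
  interpret P: mv_algebra P by fact
  let ?e = "undefined :: 'p"
  define F :: "('p \<times> 'x \<times> 'y) mv" where
    "F = \<lparr>carrier = {(e, x, y). e = ?e \<and> x \<in> carrier X \<and> y \<in> carrier Y \<and> g x = h y},
      oplus = (\<lambda>(_, x, y) (_, x', y'). (?e, x \<oplus>\<^bsub>X\<^esub> x', y \<oplus>\<^bsub>Y\<^esub> y')),
      neg = (\<lambda>(_, x, y). (?e, \<sim>\<^bsub>X\<^esub> x, \<sim>\<^bsub>Y\<^esub> y)),
      zero = (?e, \<zero>\<^bsub>X\<^esub>, \<zero>\<^bsub>Y\<^esub>)\<rparr>"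
  have F: "mv_algebra F"
  proof
    show "x \<oplus>\<^bsub>F\<^esub> y \<in> carrier F" if "x \<in> carrier F" "y \<in> carrier F" for x y
      using that homs(3,4) by (auto simp: F_def mv_hom_def X.oplus_closed Y.oplus_closed)
    show "\<sim>\<^bsub>F\<^esub> x \<in> carrier F" if "x \<in> carrier F" for x
      using that homs(3,4) by (auto simp: F_def mv_hom_def X.neg_closed Y.neg_closed)
    show "\<zero>\<^bsub>F\<^esub> \<in> carrier F"
      using homs(3,4) by (auto simp: F_def mv_hom_def X.zero_closed Y.zero_closed)
    show "(x \<oplus>\<^bsub>F\<^esub> y) \<oplus>\<^bsub>F\<^esub> z = x \<oplus>\<^bsub>F\<^esub> (y \<oplus>\<^bsub>F\<^esub> z)"
      if "x \<in> carrier F" "y \<in> carrier F" "z \<in> carrier F" for x y z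
      using that by (auto simp: F_def X.oplus_assoc Y.oplus_assoc)
    show "x \<oplus>\<^bsub>F\<^esub> y = y \<oplus>\<^bsub>F\<^esub> x" if "x \<in> carrier F" "y \<in> carrier F" for x y
      using that by (auto simp: F_def X.oplus_comm Y.oplus_comm)
    show "x \<oplus>\<^bsub>F\<^esub> \<zero>\<^bsub>F\<^esub> = x" if "x \<in> carrier F" for x
      using that by (auto simp: F_def X.oplus_zero Y.oplus_zero)
    show "\<sim>\<^bsub>F\<^esub> (\<sim>\<^bsub>F\<^esub> x) = x" if "x \<in> carrier F" for x
      using that by (auto simp: F_def X.neg_neg Y.neg_neg)
    show "x \<oplus>\<^bsub>F\<^esub> \<sim>\<^bsub>F\<^esub> \<zero>\<^bsub>F\<^esub> = \<sim>\<^bsub>F\<^esub> \<zero>\<^bsub>F\<^esub>" if "x \<in> carrier F" for x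
      using that by (auto simp: F_def X.oplus_neg_zero Y.oplus_neg_zero)
    show "\<sim>\<^bsub>F\<^esub> (\<sim>\<^bsub>F\<^esub> x \<oplus>\<^bsub>F\<^esub> y) \<oplus>\<^bsub>F\<^esub> y = \<sim>\<^bsub>F\<^esub> (\<sim>\<^bsub>F\<^esub> y \<oplus>\<^bsub>F\<^esub> x) \<oplus>\<^bsub>F\<^esub> x"
      if "x \<in> carrier F" "y \<in> carrier F" for x y
      using that by (auto simp: F_def intro: X.lukasiewicz Y.lukasiewicz)
  qed
  have "(\<lambda>c. fst (snd c)) \<in> mv_hom F X" "(\<lambda>c. snd (snd c)) \<in> mv_hom F Y"
    "\<forall>c\<in>carrier F. g (fst (snd c)) = h (snd (snd c))"
    by (auto simp: F_def mv_hom_def)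
  from univ[OF F this] obtain s where s: "s \<in> mv_hom F P"
    "\<And>c. c \<in> carrier F \<Longrightarrow> p1 (s c) = fst (snd c)"
    "\<And>c. c \<in> carrier F \<Longrightarrow> p2 (s c) = snd (snd c)" by blast
  have into_F: "(\<lambda>c. (?e, q1 c, q2 c)) \<in> mv_hom Q F"
    if "q1 \<in> mv_hom Q X" "q2 \<in> mv_hom Q Y" "\<forall>c\<in>carrier Q. g (q1 c) = h (q2 c)"
    for Q :: "'c mv" and q1 q2
    using that by (auto simp: F_def mv_hom_def Pi_iff)
  define P' :: "('p \<times> 'x \<times> 'y) mv" where
    "P' = \<lparr>carrier = {(a, x, y). a \<in> carrier P \<and> x = undefined \<and> y = undefined},
      oplus = (\<lambda>(a, _) (b, _). (a \<oplus>\<^bsub>P\<^esub> b, undefined, undefined)),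
      neg = (\<lambda>(a, _). (\<sim>\<^bsub>P\<^esub> a, undefined, undefined)), zero = (\<zero>\<^bsub>P\<^esub>, undefined, undefined)\<rparr>"
  have P': "mv_algebra P'"
  proof
    show "x \<oplus>\<^bsub>P'\<^esub> y \<in> carrier P'" if "x \<in> carrier P'" "y \<in> carrier P'" for x y
      using that by (auto simp: P'_def P.oplus_closed)
    show "\<sim>\<^bsub>P'\<^esub> x \<in> carrier P'" if "x \<in> carrier P'" for x
      using that by (auto simp: P'_def P.neg_closed)
    show "\<zero>\<^bsub>P'\<^esub> \<in> carrier P'"
      by (auto simp: P'_def P.zero_closed)
    show "(x \<oplus>\<^bsub>P'\<^esub> y) \<oplus>\<^bsub>P'\<^esub> z = x \<oplus>\<^bsub>P'\<^esub> (y \<oplus>\<^bsub>P'\<^esub> z)"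
      if "x \<in> carrier P'" "y \<in> carrier P'" "z \<in> carrier P'" for x y z
      using that by (auto simp: P'_def P.oplus_assoc)
    show "x \<oplus>\<^bsub>P'\<^esub> y = y \<oplus>\<^bsub>P'\<^esub> x" if "x \<in> carrier P'" "y \<in> carrier P'" for x y
      using that by (auto simp: P'_def P.oplus_comm)
    show "x \<oplus>\<^bsub>P'\<^esub> \<zero>\<^bsub>P'\<^esub> = x" if "x \<in> carrier P'" for x
      using that by (auto simp: P'_def P.oplus_zero)
    show "\<sim>\<^bsub>P'\<^esub> (\<sim>\<^bsub>P'\<^esub> x) = x" if "x \<in> carrier P'" for x
      using that by (auto simp: P'_def P.neg_neg)
    show "x \<oplus>\<^bsub>P'\<^esub> \<sim>\<^bsub>P'\<^esub> \<zero>\<^bsub>P'\<^esub> = \<sim>\<^bsub>P'\<^esub> \<zero>\<^bsub>P'\<^esub>" if "x \<in> carrier P'" for x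
      using that by (auto simp: P'_def P.oplus_neg_zero)
    show "\<sim>\<^bsub>P'\<^esub> (\<sim>\<^bsub>P'\<^esub> x \<oplus>\<^bsub>P'\<^esub> y) \<oplus>\<^bsub>P'\<^esub> y = \<sim>\<^bsub>P'\<^esub> (\<sim>\<^bsub>P'\<^esub> y \<oplus>\<^bsub>P'\<^esub> x) \<oplus>\<^bsub>P'\<^esub> x"
      if "x \<in> carrier P'" "y \<in> carrier P'" for x y
      using that by (auto simp: P'_def intro: P.lukasiewicz)
  qed
  have fst_hom: "fst \<in> mv_hom P' P"
    by (auto simp: P'_def mv_hom_def)
  have fst_mem: "fst c \<in> carrier P" if "c \<in> carrier P'" for c
    using that by (auto simp: P'_def)
  have p_hom: "(\<lambda>c. p1 (fst c)) \<in> mv_hom P' X" "(\<lambda>c. p2 (fst c)) \<in> mv_hom P' Y"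
    and p_comm: "\<forall>c\<in>carrier P'. g (p1 (fst c)) = h (p2 (fst c))"
    using mv_hom_comp[OF fst_hom] homs comm fst_mem by auto
  obtain w where w: "\<And>v c. v \<in> mv_hom P' P \<Longrightarrow>
      (\<forall>c\<in>carrier P'. p1 (v c) = p1 (fst c) \<and> p2 (v c) = p2 (fst c)) \<Longrightarrow>
      c \<in> carrier P' \<Longrightarrow> v c = w c"
    using univ[OF P' p_hom p_comm] by blast
  have P'_into_F: "(\<lambda>c. (?e, p1 (fst c), p2 (fst c))) \<in> mv_hom P' F"
    using p_hom p_comm by (auto simp: F_def mv_hom_def Pi_iff)
  have retr: "s (?e, p1 a, p2 a) = a" if a: "a \<in> carrier P" for a
  proof -
    let ?v = "\<lambda>c. s (?e, p1 (fst c), p2 (fst c))"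
    have v: "?v \<in> mv_hom P' P"
      using mv_hom_comp[OF P'_into_F s(1)] .
    have vF: "(?e, p1 (fst c), p2 (fst c)) \<in> carrier F" if "c \<in> carrier P'" for c
      using P'_into_F that unfolding mv_hom_def by blast
    have c: "(a, undefined, undefined) \<in> carrier P'"
      using a by (simp add: P'_def)
    have "?v (a, undefined, undefined) = w (a, undefined, undefined)"
      using w[of ?v, OF v _ c] s(2,3) vF by auto
    moreover have "fst (a, undefined, undefined) = w (a, undefined, undefined)"
      using w[of fst, OF fst_hom _ c] by simp
    ultimately show ?thesis by simp
  qed
  have "\<exists>u\<in>mv_hom Q P.
           (\<forall>c\<in>carrier Q. p1 (u c) = q1 c \<and> p2 (u c) = q2 c) \<and>
           (\<forall>v\<in>mv_hom Q P.
              (\<forall>c\<in>carrier Q. p1 (v c) = q1 c \<and> p2 (v c) = q2 c) \<longrightarrow>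
              (\<forall>c\<in>carrier Q. v c = u c))"
    if q: "q1 \<in> mv_hom Q X" "q2 \<in> mv_hom Q Y" "\<forall>c\<in>carrier Q. g (q1 c) = h (q2 c)"
    for Q :: "'c mv" and q1 q2
  proof (rule bexI[of _ "\<lambda>c. s (?e, q1 c, q2 c)"], intro conjI ballI impI)
    show "(\<lambda>c. s (?e, q1 c, q2 c)) \<in> mv_hom Q P"
      using mv_hom_comp[OF into_F[OF q] s(1)] .
    fix c assume c: "c \<in> carrier Q"
    have qF: "(?e, q1 c, q2 c) \<in> carrier F"
      using into_F[OF q] c unfolding mv_hom_def by blast
    show "p1 (s (?e, q1 c, q2 c)) = q1 c" "p2 (s (?e, q1 c, q2 c)) = q2 c"
      using s(2,3)[OF qF] by simp_all
  next
    fix v c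
    assume v: "v \<in> mv_hom Q P" "\<forall>c\<in>carrier Q. p1 (v c) = q1 c \<and> p2 (v c) = q2 c"
      and c: "c \<in> carrier Q"
    then have "v c \<in> carrier P" by (auto simp: mv_hom_def)
    from retr[OF this] v(2) c show "v c = s (?e, q1 c, q2 c)" by simp
  qed
  with alg homs comm show ?thesis
    unfolding mv_pullback_wrt_def by blast
qed

definition trivial_extension :: "'a mv \<Rightarrow> 'b mv \<Rightarrow> ('a \<Rightarrow> 'b) \<Rightarrow> bool" where
  "trivial_extension A B f \<longleftrightarrow>
     mv_pullback A (S_obj A) B (S_obj B) (eta A) f (S_map B f) (eta B)"

end

theory Submission
  imports Defs
begin

text \<open>
  The square is a pullback iff every pair \<open>(a, b)\<close> with \<open>f a\<close> and \<open>b\<close> congruent modulo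
  \<open>Rad B\<close> has exactly one lift \<open>a'\<close> congruent to \<open>a\<close> modulo \<open>Rad A\<close> with \<open>f a' = b\<close>.
  Taking \<open>a = 0\<close>, this makes \<open>f\<close> a bijection \<open>Rad A \<rightarrow> Rad B\<close>, hence \<open>P f\<close> is bijective unless
  \<open>Rad B\<close> meets \<open>\<not>Rad B\<close>, that is, unless \<open>B\<close> is trivial. Conversely, if \<open>P f\<close> is bijective,
  write \<open>f a \<ominus> b = f s\<close> and \<open>b \<ominus> f a = f r\<close> with \<open>s\<close>, \<open>r\<close> in \<open>Rad A\<close>; then \<open>(a \<ominus> s) \<oplus> r\<close> is the
  required lift.
\<close>

section \<open>Arithmetic and order\<close>

context mv_algebra
begin

declare oplus_closed [simp, intro] neg_closed [simp, intro] zero_closed [simp, intro]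
  oplus_zero [simp] neg_neg [simp]

lemma one_closed [simp, intro]: "\<one> \<in> carrier A"
  by (simp add: mv_one_def)

lemma minus_closed [simp, intro]: "x \<in> carrier A \<Longrightarrow> y \<in> carrier A \<Longrightarrow> x \<ominus> y \<in> carrier A"
  by (simp add: mv_minus_def)

lemma oplus_left_comm:
  "x \<in> carrier A \<Longrightarrow> y \<in> carrier A \<Longrightarrow> z \<in> carrier A \<Longrightarrow> x \<oplus> (y \<oplus> z) = y \<oplus> (x \<oplus> z)"
  by (metis oplus_assoc oplus_comm)

lemmas oplus_ac = oplus_assoc oplus_comm oplus_left_comm

lemma zero_oplus [simp]: "x \<in> carrier A \<Longrightarrow> \<zero> \<oplus> x = x"
  using oplus_comm[of "\<zero>" x] by simp

lemma neg_one [simp]: "\<sim> \<one> = \<zero>"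
  by (simp add: mv_one_def)

lemma neg_zero [simp]: "\<sim> \<zero> = \<one>"
  by (simp add: mv_one_def)

lemma oplus_one [simp]: "x \<in> carrier A \<Longrightarrow> x \<oplus> \<one> = \<one>"
  using oplus_neg_zero by simp

lemma one_oplus [simp]: "x \<in> carrier A \<Longrightarrow> \<one> \<oplus> x = \<one>"
  using oplus_comm[of "\<one>" x] by simp

text \<open>Setting the second argument of \<open>lukasiewicz\<close> to \<open>\<one>\<close>
  collapses its left side to \<open>\<one>\<close> and its right side to the sum in
  question.\<close>

lemma neg_oplus_self [simp]: "x \<in> carrier A \<Longrightarrow> \<sim> x \<oplus> x = \<one>"
  using lukasiewicz[of x "\<one>"] by simp

lemma minus_oplus_of_le:
  assumes "x \<in> carrier A" "y \<in> carrier A" "x \<sqsubseteq> y"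
  shows "(y \<ominus> x) \<oplus> x = y"
  using assms lukasiewicz[of x y] by (simp add: mv_le_def mv_minus_def)

text \<open>The order is the algebraic one, with witness \<open>y \<ominus> x\<close>. Transitivity
  and monotonicity of sums then reduce to associativity and commutativity.\<close>

lemma le_iff_oplus:
  assumes "x \<in> carrier A" "y \<in> carrier A"
  shows "x \<sqsubseteq> y \<longleftrightarrow> (\<exists>z\<in>carrier A. y = x \<oplus> z)"
proof
  assume "x \<sqsubseteq> y"
  then show "\<exists>z\<in>carrier A. y = x \<oplus> z"
    using assms minus_oplus_of_le[of x y] oplus_comm[of "y \<ominus> x" x]
    by (intro bexI[of _ "y \<ominus> x"]) auto
next
  assume "\<exists>z\<in>carrier A. y = x \<oplus> z"
  then show "x \<sqsubseteq> y"
    using assms by (auto simp: mv_le_def simp flip: oplus_assoc)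
qed

lemma le_oplus [simp]: "x \<in> carrier A \<Longrightarrow> z \<in> carrier A \<Longrightarrow> x \<sqsubseteq> x \<oplus> z"
  by (subst le_iff_oplus) auto

lemma le_oplus2 [simp]: "x \<in> carrier A \<Longrightarrow> z \<in> carrier A \<Longrightarrow> x \<sqsubseteq> z \<oplus> x"
  using le_oplus[of x z] by (simp add: oplus_comm)

lemma le_refl [simp]: "x \<in> carrier A \<Longrightarrow> x \<sqsubseteq> x"
  by (simp add: mv_le_def)

lemma le_trans:
  assumes "x \<in> carrier A" "y \<in> carrier A" "z \<in> carrier A" "x \<sqsubseteq> y" "y \<sqsubseteq> z"
  shows "x \<sqsubseteq> z"
  using assms by (auto simp: le_iff_oplus oplus_assoc)

text \<open>Under the two inequalities the sides of \<open>lukasiewicz\<close> reduce to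
  \<open>y\<close> and \<open>x\<close>.\<close>

lemma le_antisym:
  assumes "x \<in> carrier A" "y \<in> carrier A" "x \<sqsubseteq> y" "y \<sqsubseteq> x"
  shows "x = y"
  using assms lukasiewicz[of x y] by (simp add: mv_le_def)

lemma oplus_mono:
  assumes "x \<in> carrier A" "y \<in> carrier A" "x' \<in> carrier A" "y' \<in> carrier A"
    and "x \<sqsubseteq> y" "x' \<sqsubseteq> y'"
  shows "x \<oplus> x' \<sqsubseteq> y \<oplus> y'"
proof -
  obtain z z' where z: "z \<in> carrier A" "z' \<in> carrier A" "y = x \<oplus> z" "y' = x' \<oplus> z'"
    using assms by (auto simp: le_iff_oplus)
  then have "y \<oplus> y' = (x \<oplus> x') \<oplus> (z \<oplus> z')"
    using assms by (simp add: oplus_ac)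
  then show ?thesis
    using z assms by simp
qed

lemma neg_le_neg:
  "x \<in> carrier A \<Longrightarrow> y \<in> carrier A \<Longrightarrow> x \<sqsubseteq> y \<Longrightarrow> \<sim> y \<sqsubseteq> \<sim> x"
  by (simp add: mv_le_def oplus_comm)

text \<open>Residuation: by associativity both sides unfold to the same equation, with
  \<open>\<sim> x \<oplus> y \<oplus> z\<close> equal to \<open>\<one>\<close>.\<close>

lemma minus_le_iff:
  "x \<in> carrier A \<Longrightarrow> y \<in> carrier A \<Longrightarrow> z \<in> carrier A \<Longrightarrow> x \<ominus> y \<sqsubseteq> z \<longleftrightarrow> x \<sqsubseteq> y \<oplus> z"
  by (simp add: mv_le_def mv_minus_def oplus_assoc)

lemma zero_le [simp]: "x \<in> carrier A \<Longrightarrow> \<zero> \<sqsubseteq> x"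
  by (simp add: mv_le_def)

lemma le_zero: "x \<in> carrier A \<Longrightarrow> x \<sqsubseteq> \<zero> \<Longrightarrow> x = \<zero>"
  by (rule le_antisym) auto

lemma minus_zero [simp]: "x \<in> carrier A \<Longrightarrow> x \<ominus> \<zero> = x"
  and zero_minus [simp]: "x \<in> carrier A \<Longrightarrow> \<zero> \<ominus> x = \<zero>"
  and minus_self [simp]: "x \<in> carrier A \<Longrightarrow> x \<ominus> x = \<zero>"
  by (simp_all add: mv_minus_def)

lemma dist_zero_left [simp]: "x \<in> carrier A \<Longrightarrow> mv_dist A \<zero> x = x"
  by (simp add: mv_dist_def)

lemma minus_eq_zero_imp_le:
  "x \<in> carrier A \<Longrightarrow> y \<in> carrier A \<Longrightarrow> x \<ominus> y = \<zero> \<Longrightarrow> x \<sqsubseteq> y"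
  using minus_le_iff[of x y "\<zero>"] by simp

lemma minus_le: "x \<in> carrier A \<Longrightarrow> y \<in> carrier A \<Longrightarrow> x \<ominus> y \<sqsubseteq> x"
  by (simp add: minus_le_iff)

lemma le_minus_oplus: "x \<in> carrier A \<Longrightarrow> y \<in> carrier A \<Longrightarrow> x \<sqsubseteq> y \<oplus> (x \<ominus> y)"
  by (simp flip: minus_le_iff)

text \<open>Here \<open>x \<ominus> (x \<ominus> y)\<close> is the meet of \<open>x\<close> and \<open>y\<close>, and \<open>y \<ominus> x = y \<ominus> (x \<sqinter> y)\<close>.\<close>

lemma minus_minus_oplus:
  assumes x: "x \<in> carrier A" and y: "y \<in> carrier A"
  shows "(x \<ominus> (x \<ominus> y)) \<oplus> (y \<ominus> x) = y"
proof -
  let ?m = "x \<ominus> (x \<ominus> y)"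
  \<comment> \<open>The axiom \<open>lukasiewicz\<close> for the complements, after negation, says
    that the meet is commutative. The goal then becomes the decomposition of \<open>y\<close> along
    \<open>y \<ominus> x\<close>, which lies below \<open>y\<close>.\<close>
  have comm: "?m = y \<ominus> (y \<ominus> x)"
    using lukasiewicz[of "\<sim> x" "\<sim> y"] x y by (simp add: mv_minus_def oplus_comm)
  show ?thesis
    unfolding comm using minus_oplus_of_le[of "y \<ominus> x" y] x y by (simp add: minus_le)
qed

text \<open>If \<open>\<one> = \<zero>\<close>, every \<open>x\<close> equals
  \<open>x \<oplus> \<zero> = x \<oplus> \<one> = \<one>\<close>.\<close>

lemma carrier_trivial_iff: "carrier A = {\<zero>} \<longleftrightarrow> \<one> = \<zero>"
proof
  assume 1: "\<one> = \<zero>"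
  have "x = \<zero>" if "x \<in> carrier A" for x
    using oplus_one[OF that] oplus_zero[OF that] 1 by simp
  then show "carrier A = {\<zero>}"
    by blast
qed (use one_closed in blast)

section \<open>Ideals and quotients\<close>

lemma idealD:
  assumes "mv_ideal A I"
  shows "x \<in> I \<Longrightarrow> x \<in> carrier A" "\<zero> \<in> I" "x \<in> I \<Longrightarrow> y \<in> I \<Longrightarrow> x \<oplus> y \<in> I"
    and "x \<in> I \<Longrightarrow> y \<in> carrier A \<Longrightarrow> y \<sqsubseteq> x \<Longrightarrow> y \<in> I"
  using assms by (auto simp: mv_ideal_def)

lemma ideal_eq_carrier_iff:
  assumes "mv_ideal A I"
  shows "I = carrier A \<longleftrightarrow> \<one> \<in> I"
proof
  assume "\<one> \<in> I"
  moreover have "x \<sqsubseteq> \<one>" if "x \<in> carrier A" for x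
    using that by (simp add: mv_le_def)
  ultimately show "I = carrier A"
    using idealD(1,4)[OF assms] by blast
qed auto

lemma ideal_dist_iff:
  assumes I: "mv_ideal A I" and "x \<in> carrier A" "y \<in> carrier A"
  shows "mv_dist A x y \<in> I \<longleftrightarrow> x \<ominus> y \<in> I \<and> y \<ominus> x \<in> I"
proof
  assume d: "mv_dist A x y \<in> I"
  have "x \<ominus> y \<sqsubseteq> mv_dist A x y" "y \<ominus> x \<sqsubseteq> mv_dist A x y"
    using assms by (simp_all add: mv_dist_def)
  then show "x \<ominus> y \<in> I \<and> y \<ominus> x \<in> I"
    using idealD(4)[OF I d] assms by blast
next
  assume "x \<ominus> y \<in> I \<and> y \<ominus> x \<in> I"
  then show "mv_dist A x y \<in> I"
    unfolding mv_dist_def using idealD(3)[OF I] by blast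
qed

lemma ideal_minus_iff:
  assumes I: "mv_ideal A I" and "x \<in> carrier A" "y \<in> carrier A"
  shows "x \<ominus> y \<in> I \<longleftrightarrow> (\<exists>m\<in>I. x \<sqsubseteq> y \<oplus> m)"
  using assms idealD(1)[OF I] idealD(4)[OF I, of _ "x \<ominus> y"] le_minus_oplus[of x y] minus_le_iff
  by (metis minus_closed)

text \<open>Splits the congruence into two one-sided relations, each reading "below, up to an error
  in \<open>I\<close>", so that transitivity and compatibility can be checked one side at a
  time.\<close>

lemma cong_iff:
  assumes I: "mv_ideal A I"
  shows "(x, y) \<in> mv_cong A I \<longleftrightarrow> x \<in> carrier A \<and> y \<in> carrier A \<and>
    (\<exists>m\<in>I. x \<sqsubseteq> y \<oplus> m) \<and> (\<exists>m\<in>I. y \<sqsubseteq> x \<oplus> m)"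
  using ideal_dist_iff[OF I] ideal_minus_iff[OF I] by (auto simp: mv_cong_def)

text \<open>The two errors add up, and their sum stays in \<open>I\<close>.\<close>

lemma ideal_le_trans:
  assumes I: "mv_ideal A I" and xyz: "x \<in> carrier A" "y \<in> carrier A" "z \<in> carrier A"
    and "\<exists>m\<in>I. x \<sqsubseteq> y \<oplus> m" "\<exists>m\<in>I. y \<sqsubseteq> z \<oplus> m"
  shows "\<exists>m\<in>I. x \<sqsubseteq> z \<oplus> m"
proof -
  obtain m n where mn: "m \<in> I" "x \<sqsubseteq> y \<oplus> m" "n \<in> I" "y \<sqsubseteq> z \<oplus> n"
    using assms by blast
  then have c: "m \<in> carrier A" "n \<in> carrier A"
    using idealD(1)[OF I] by auto
  have "y \<oplus> m \<sqsubseteq> (z \<oplus> n) \<oplus> m"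
    using mn c xyz by (intro oplus_mono) auto
  then have "x \<sqsubseteq> z \<oplus> (n \<oplus> m)"
    using mn c xyz le_trans[of x "y \<oplus> m" "(z \<oplus> n) \<oplus> m"] by (simp add: oplus_assoc)
  then show ?thesis
    using mn idealD(3)[OF I] by blast
qed

lemma ideal_le_oplus:
  assumes I: "mv_ideal A I"
    and xy: "x \<in> carrier A" "y \<in> carrier A" "x' \<in> carrier A" "y' \<in> carrier A"
    and "\<exists>m\<in>I. x \<sqsubseteq> y \<oplus> m" "\<exists>m\<in>I. x' \<sqsubseteq> y' \<oplus> m"
  shows "\<exists>m\<in>I. x \<oplus> x' \<sqsubseteq> (y \<oplus> y') \<oplus> m"
proof -
  obtain m n where mn: "m \<in> I" "x \<sqsubseteq> y \<oplus> m" "n \<in> I" "x' \<sqsubseteq> y' \<oplus> n"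
    using assms by blast
  then have c: "m \<in> carrier A" "n \<in> carrier A"
    using idealD(1)[OF I] by auto
  have "x \<oplus> x' \<sqsubseteq> (y \<oplus> m) \<oplus> (y' \<oplus> n)"
    using mn c xy by (intro oplus_mono) auto
  also have "(y \<oplus> m) \<oplus> (y' \<oplus> n) = (y \<oplus> y') \<oplus> (m \<oplus> n)"
    using c xy by (simp add: oplus_ac)
  finally show ?thesis
    using mn idealD(3)[OF I] by blast
qed

text \<open>The same error \<open>m\<close> serves: both inequalities say that the sum of
  \<open>\<sim> x\<close>, \<open>y\<close> and \<open>m\<close> is \<open>\<one>\<close>.\<close>

lemma ideal_le_neg:
  assumes I: "mv_ideal A I" and xy: "x \<in> carrier A" "y \<in> carrier A"
    and "\<exists>m\<in>I. x \<sqsubseteq> y \<oplus> m"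
  shows "\<exists>m\<in>I. \<sim> y \<sqsubseteq> \<sim> x \<oplus> m"
  using assms idealD(1)[OF I] by (fastforce simp: mv_le_def oplus_left_comm)

lemma equiv_cong:
  assumes I: "mv_ideal A I"
  shows "equiv (carrier A) (mv_cong A I)"
proof (rule equivI)
  show "mv_cong A I \<subseteq> carrier A \<times> carrier A"
    by (auto simp: mv_cong_def)
  have "x \<sqsubseteq> x \<oplus> \<zero>" if "x \<in> carrier A" for x
    using that by simp
  then show "refl_on (carrier A) (mv_cong A I)"
    unfolding refl_on_def cong_iff[OF I] using idealD(2)[OF I] by blast
  show "sym (mv_cong A I)"
    by (auto simp: sym_def cong_iff[OF I])
  show "trans (mv_cong A I)"
    unfolding trans_def cong_iff[OF I] using ideal_le_trans[OF I] by blast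
qed

lemma cong_oplus:
  assumes I: "mv_ideal A I" and "(x, y) \<in> mv_cong A I" "(x', y') \<in> mv_cong A I"
  shows "(x \<oplus> x', y \<oplus> y') \<in> mv_cong A I"
  using assms unfolding cong_iff[OF I] by (auto intro!: ideal_le_oplus[OF I])

lemma cong_neg:
  assumes I: "mv_ideal A I" and "(x, y) \<in> mv_cong A I"
  shows "(\<sim> x, \<sim> y) \<in> mv_cong A I"
  using assms unfolding cong_iff[OF I] by (auto intro!: ideal_le_neg[OF I])

lemma cong_class_eq_iff:
  assumes "mv_ideal A I" "x \<in> carrier A" "y \<in> carrier A"
  shows "mv_cong A I `` {x} = mv_cong A I `` {y} \<longleftrightarrow> mv_dist A x y \<in> I"
  using eq_equiv_class_iff[OF equiv_cong] assms by (simp add: mv_cong_def)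

section \<open>Operations on congruence classes\<close>

lemma quotient_oplus:
  assumes I: "mv_ideal A I" and "x \<in> carrier A" "y \<in> carrier A"
  shows "mv_cong A I `` {x} \<oplus>\<^bsub>mv_quotient A I\<^esub> mv_cong A I `` {y} = mv_cong A I `` {x \<oplus> y}"
proof -
  \<comment> \<open>Compatibility makes all sets in the union that defines the sum equal, so the
    union is a single class.\<close>
  have "congruent2 (mv_cong A I) (mv_cong A I) (\<lambda>x y. mv_cong A I `` {x \<oplus> y})"
    using cong_oplus[OF I] by (intro congruent2I' equiv_class_eq[OF equiv_cong[OF I]]) auto
  then show ?thesis
    using UN_equiv_class2[OF equiv_cong[OF I] equiv_cong[OF I]] assms
    by (simp add: mv_quotient_def)
qed

lemma quotient_neg:
  assumes I: "mv_ideal A I" and "x \<in> carrier A"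
  shows "\<sim>\<^bsub>mv_quotient A I\<^esub> (mv_cong A I `` {x}) = mv_cong A I `` {\<sim> x}"
proof -
  have "congruent (mv_cong A I) (\<lambda>x. mv_cong A I `` {\<sim> x})"
    using cong_neg[OF I] by (intro congruentI equiv_class_eq[OF equiv_cong[OF I]]) auto
  then show ?thesis
    using UN_equiv_class[OF equiv_cong[OF I]] assms by (simp add: mv_quotient_def)
qed

lemma quotient_carrier: "carrier (mv_quotient A I) = (\<lambda>x. mv_cong A I `` {x}) ` carrier A"
  and quotient_zero: "\<zero>\<^bsub>mv_quotient A I\<^esub> = mv_cong A I `` {\<zero>}"
  by (auto simp: mv_quotient_def quotient_def)

text \<open>The axioms are equations, hence pass along the surjective class map once the operations
  are computed on representatives.\<close>

lemma mv_algebra_quotient: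
  assumes I: "mv_ideal A I"
  shows "mv_algebra (mv_quotient A I)"
proof -
  note ops = quotient_carrier quotient_zero quotient_oplus[OF I] quotient_neg[OF I]
  show ?thesis
  proof
    fix X Y Z
    assume X: "X \<in> carrier (mv_quotient A I)"
    show "\<sim>\<^bsub>mv_quotient A I\<^esub> X \<in> carrier (mv_quotient A I)"
      "X \<oplus>\<^bsub>mv_quotient A I\<^esub> \<zero>\<^bsub>mv_quotient A I\<^esub> = X"
      "\<sim>\<^bsub>mv_quotient A I\<^esub> (\<sim>\<^bsub>mv_quotient A I\<^esub> X) = X"
      "X \<oplus>\<^bsub>mv_quotient A I\<^esub> \<sim>\<^bsub>mv_quotient A I\<^esub> \<zero>\<^bsub>mv_quotient A I\<^esub> =
        \<sim>\<^bsub>mv_quotient A I\<^esub> \<zero>\<^bsub>mv_quotient A I\<^esub>"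
      using X unfolding quotient_carrier by (elim imageE; simp add: ops)+
    assume Y: "Y \<in> carrier (mv_quotient A I)"
    obtain x y where xy: "x \<in> carrier A" "X = mv_cong A I `` {x}"
      "y \<in> carrier A" "Y = mv_cong A I `` {y}"
      using X Y unfolding quotient_carrier by blast
    then show "X \<oplus>\<^bsub>mv_quotient A I\<^esub> Y \<in> carrier (mv_quotient A I)"
      "X \<oplus>\<^bsub>mv_quotient A I\<^esub> Y = Y \<oplus>\<^bsub>mv_quotient A I\<^esub> X"
      "\<sim>\<^bsub>mv_quotient A I\<^esub> (\<sim>\<^bsub>mv_quotient A I\<^esub> X \<oplus>\<^bsub>mv_quotient A I\<^esub> Y) \<oplus>\<^bsub>mv_quotient A I\<^esub> Y =
        \<sim>\<^bsub>mv_quotient A I\<^esub> (\<sim>\<^bsub>mv_quotient A I\<^esub> Y \<oplus>\<^bsub>mv_quotient A I\<^esub> X) \<oplus>\<^bsub>mv_quotient A I\<^esub> X"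
      using oplus_comm[of x y] lukasiewicz[of x y] by (simp_all add: ops)
    assume "Z \<in> carrier (mv_quotient A I)"
    then show "(X \<oplus>\<^bsub>mv_quotient A I\<^esub> Y) \<oplus>\<^bsub>mv_quotient A I\<^esub> Z =
        X \<oplus>\<^bsub>mv_quotient A I\<^esub> (Y \<oplus>\<^bsub>mv_quotient A I\<^esub> Z)"
      using xy unfolding quotient_carrier by (elim imageE) (simp add: ops oplus_assoc)
  next
    show "\<zero>\<^bsub>mv_quotient A I\<^esub> \<in> carrier (mv_quotient A I)"
      by (simp add: ops)
  qed
qed

section \<open>Maximal ideals and the radical\<close>

text \<open>The \<open>n\<close>-fold sum of \<open>x\<close>, used for the archimedean description
  of maximal ideals.\<close>

primrec mult :: "nat \<Rightarrow> 'a \<Rightarrow> 'a" where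
  "mult 0 x = \<zero>"
| "mult (Suc n) x = x \<oplus> mult n x"

lemma mult_closed [simp, intro]: "x \<in> carrier A \<Longrightarrow> mult n x \<in> carrier A"
  by (induction n) auto

lemma mult_add: "x \<in> carrier A \<Longrightarrow> mult (m + n) x = mult m x \<oplus> mult n x"
  by (induction m) (auto simp: oplus_assoc)

lemma ideal_mult: "mv_ideal A I \<Longrightarrow> x \<in> I \<Longrightarrow> mult n x \<in> I"
  by (induction n) (auto intro: idealD(2,3))

text \<open>A strictly larger ideal contains some \<open>x\<close> outside \<open>M\<close>, hence
  both \<open>mult n x\<close> and its complement, whose sum is \<open>\<one>\<close>. This
  criterion, unlike maximality itself, transfers directly to preimages under morphisms.\<close>

lemma maximal_idealI:
  assumes M: "mv_ideal A M" "\<one> \<notin> M"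
    and arch: "\<And>x. x \<in> carrier A \<Longrightarrow> x \<notin> M \<Longrightarrow> \<exists>n. \<sim> (mult n x) \<in> M"
  shows "mv_maximal_ideal A M"
  unfolding mv_maximal_ideal_def
proof (intro conjI allI impI)
  fix I assume I: "mv_ideal A I \<and> I \<noteq> carrier A \<and> M \<subseteq> I"
  show "I = M"
  proof (rule ccontr)
    assume "I \<noteq> M"
    then obtain x where x: "x \<in> I" "x \<notin> M" "x \<in> carrier A"
      using I idealD(1) by blast
    then obtain n where "\<sim> (mult n x) \<in> M"
      using arch by blast
    then have "\<sim> (mult n x) \<oplus> mult n x \<in> I"
      using I x by (meson idealD(3) ideal_mult subsetD)
    then show False
      using I x ideal_eq_carrier_iff by auto
  qed
qed (use M ideal_eq_carrier_iff in auto)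

text \<open>The ideal generated by \<open>M\<close> and \<open>x\<close> contains
  \<open>\<one>\<close> by maximality, and \<open>\<one> \<sqsubseteq> m \<oplus> mult n x\<close>
  means that \<open>\<sim> (mult n x)\<close> lies below \<open>m\<close>.\<close>

lemma maximal_ideal_archimedean:
  assumes M: "mv_maximal_ideal A M" and x: "x \<in> carrier A" "x \<notin> M"
  shows "\<exists>n. \<sim> (mult n x) \<in> M"
proof -
  have I: "mv_ideal A M"
    using M by (simp add: mv_maximal_ideal_def)
  \<comment> \<open>The ideal generated by \<open>M\<close> and \<open>x\<close>. The multiples 0
    and 1 will show that it contains \<open>M\<close> and \<open>x\<close>.\<close>
  define J where "J = {y \<in> carrier A. \<exists>m\<in>M. \<exists>n. y \<sqsubseteq> m \<oplus> mult n x}"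
  have J: "mv_ideal A J"
    unfolding mv_ideal_def
  proof (intro conjI ballI impI)
    show "J \<subseteq> carrier A" "\<zero> \<in> J"
      using idealD(1,2)[OF I] x by (auto simp: J_def)
  next
    fix y z assume "y \<in> J" "z \<in> J"
    then obtain m n k l where *: "y \<in> carrier A" "z \<in> carrier A" "m \<in> M" "n \<in> M"
      "y \<sqsubseteq> m \<oplus> mult k x" "z \<sqsubseteq> n \<oplus> mult l x"
      by (auto simp: J_def)
    then have c: "m \<in> carrier A" "n \<in> carrier A"
      using idealD(1)[OF I] by auto
    have "y \<oplus> z \<sqsubseteq> (m \<oplus> mult k x) \<oplus> (n \<oplus> mult l x)"
      using * c x by (intro oplus_mono) auto
    also have "\<dots> = (m \<oplus> n) \<oplus> mult (k + l) x"
      using c x by (simp add: mult_add oplus_ac)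
    finally show "y \<oplus> z \<in> J"
      using * idealD(3)[OF I] by (auto simp: J_def)
  next
    fix y z assume *: "y \<in> J" "z \<in> carrier A" "z \<sqsubseteq> y"
    then obtain m n where mn: "y \<in> carrier A" "m \<in> M" "y \<sqsubseteq> m \<oplus> mult n x"
      by (auto simp: J_def)
    then have "z \<sqsubseteq> m \<oplus> mult n x"
      using le_trans[OF _ _ _ *(3), of "m \<oplus> mult n x"] *(2) x idealD(1)[OF I] by simp
    then show "z \<in> J"
      using * mn by (auto simp: J_def)
  qed
  have "M \<subseteq> J"
  proof
    fix y assume "y \<in> M"
    moreover from this have "y \<in> carrier A" by (rule idealD(1)[OF I])
    moreover have "y \<sqsubseteq> y \<oplus> mult 0 x" using \<open>y \<in> carrier A\<close> by simp
    ultimately show "y \<in> J" unfolding J_def by blast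
  qed
  moreover have "x \<in> J"
  proof -
    have "x \<sqsubseteq> \<zero> \<oplus> mult 1 x" using x by simp
    then show ?thesis unfolding J_def using x idealD(2)[OF I] by blast
  qed
  ultimately have "\<one> \<in> J"
    using M J x ideal_eq_carrier_iff unfolding mv_maximal_ideal_def by blast
  then obtain m n where mn: "m \<in> M" "\<one> \<sqsubseteq> m \<oplus> mult n x"
    by (auto simp: J_def)
  then have "\<sim> (mult n x) \<sqsubseteq> m"
    using idealD(1)[OF I] x by (simp add: mv_le_def oplus_comm)
  then show ?thesis
    using idealD(4)[OF I mn(1)] x by blast
qed

text \<open>Linearity of the chain matters for sums: the larger of two members contains both
  summands.\<close>

lemma ideal_Union_chain:
  assumes chain: "subset.chain {I. mv_ideal A I} C" and ne: "C \<noteq> {}"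
  shows "mv_ideal A (\<Union>C)"
proof -
  have C: "mv_ideal A I" if "I \<in> C" for I
    using that chain by (auto simp: subset.chain_def)
  have "x \<oplus> y \<in> \<Union>C" if xy: "x \<in> \<Union>C" "y \<in> \<Union>C" for x y
  proof -
    obtain I J where IJ: "I \<in> C" "x \<in> I" "J \<in> C" "y \<in> J"
      using xy by blast
    then have "I \<subseteq> J \<or> J \<subseteq> I"
      using chain by (auto simp: subset_chain_def)
    then show ?thesis
      using IJ idealD(3)[OF C] by blast
  qed
  moreover have "y \<in> \<Union>C" if "x \<in> \<Union>C" "y \<in> carrier A" "y \<sqsubseteq> x" for x y
    using that idealD(4)[OF C] by blast
  moreover have "\<Union>C \<subseteq> carrier A" "\<zero> \<in> \<Union>C"
    using ne idealD(1,2)[OF C] by blast+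
  ultimately show ?thesis
    unfolding mv_ideal_def by blast
qed

text \<open>Zorn's lemma applied to the ideals that omit \<open>\<one>\<close>. Omitting
  \<open>\<one>\<close> is the same as being proper, and visibly survives unions of chains.
  Nontriviality puts the zero ideal into this family.\<close>

lemma ex_maximal_ideal:
  assumes nt: "\<one> \<noteq> \<zero>"
  shows "\<exists>M. mv_maximal_ideal A M"
proof -
  let ?P = "{I. mv_ideal A I \<and> \<one> \<notin> I}"
  have "mv_ideal A {\<zero>}"
    using le_zero by (auto simp: mv_ideal_def)
  then have "?P \<noteq> {}"
    using nt by blast
  moreover have "\<Union>C \<in> ?P" if "C \<noteq> {}" "subset.chain ?P C" for C
  proof -
    have "subset.chain {I. mv_ideal A I} C"
      using that by (auto simp: subset_chain_def)
    then show ?thesis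
      using that ideal_Union_chain by (auto simp: subset_chain_def)
  qed
  ultimately obtain M where "M \<in> ?P" "\<forall>I\<in>?P. M \<subseteq> I \<longrightarrow> I = M"
    using subset_Zorn_nonempty[of ?P] by blast
  then show ?thesis
    using ideal_eq_carrier_iff unfolding mv_maximal_ideal_def by blast
qed

section \<open>The radical\<close>

lemma ideal_Rad: "mv_ideal A (Rad A)"
proof -
  have M: "mv_ideal A M" if "mv_maximal_ideal A M" for M
    using that by (simp add: mv_maximal_ideal_def)
  show ?thesis
    unfolding mv_ideal_def Rad_def
    by (auto intro: idealD(2,3)[OF M] idealD(4)[OF M])
qed

text \<open>A nontrivial algebra has a maximal ideal, and that ideal omits
  \<open>\<one>\<close>.\<close>

lemma one_in_Rad_iff: "\<one> \<in> Rad A \<longleftrightarrow> \<one> = \<zero>"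
proof
  assume 1: "\<one> \<in> Rad A"
  have "\<one> \<notin> M" if "mv_maximal_ideal A M" for M
    using that ideal_eq_carrier_iff by (auto simp: mv_maximal_ideal_def)
  then show "\<one> = \<zero>"
    using 1 ex_maximal_ideal by (auto simp: Rad_def)
qed (simp add: idealD(2)[OF ideal_Rad])

text \<open>The sum of \<open>x\<close> and its complement is \<open>\<one>\<close>. So the two
  halves of P(A) are disjoint in a nontrivial algebra.\<close>

lemma Rad_inter_neg_Rad:
  assumes "x \<in> Rad A" "\<sim> x \<in> Rad A"
  shows "\<one> = \<zero>"
  using idealD(3)[OF ideal_Rad assms(2,1)] idealD(1)[OF ideal_Rad assms(1)] one_in_Rad_iff
  by simp

section \<open>The subalgebra P(A)\<close>

lemma P_carrier: "carrier (P_obj A) = {x \<in> carrier A. x \<in> Rad A \<or> \<sim> x \<in> Rad A}"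
  using idealD(1)[OF ideal_Rad] by (auto simp: P_obj_def mv_neg_set_def)

lemma P_ops [simp]: "oplus (P_obj A) = oplus A" "neg (P_obj A) = neg A" "zero (P_obj A) = zero A"
  by (simp_all add: P_obj_def)

text \<open>Adding \<open>y\<close> makes the complement smaller, and the radical is downward
  closed.\<close>

lemma neg_oplus_in_Rad:
  assumes "x \<in> carrier A" "y \<in> carrier A" "\<sim> x \<in> Rad A"
  shows "\<sim> (x \<oplus> y) \<in> Rad A"
  using assms idealD(4)[OF ideal_Rad assms(3)] neg_le_neg[of x "x \<oplus> y"] by simp

lemma P_oplus_closed:
  assumes "x \<in> carrier (P_obj A)" "y \<in> carrier (P_obj A)"
  shows "x \<oplus> y \<in> carrier (P_obj A)"
  using assms neg_oplus_in_Rad[of x y] neg_oplus_in_Rad[of y x] idealD(3)[OF ideal_Rad]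
  by (auto simp: P_carrier oplus_comm)

lemma mv_algebra_P: "mv_algebra (P_obj A)"
proof
  fix x y z
  show "\<zero>\<^bsub>P_obj A\<^esub> \<in> carrier (P_obj A)"
    by (simp add: P_carrier idealD(2)[OF ideal_Rad])
  assume x: "x \<in> carrier (P_obj A)"
  then have xA: "x \<in> carrier A"
    by (simp add: P_carrier)
  then show "x \<oplus>\<^bsub>P_obj A\<^esub> \<zero>\<^bsub>P_obj A\<^esub> = x" "\<sim>\<^bsub>P_obj A\<^esub> (\<sim>\<^bsub>P_obj A\<^esub> x) = x"
    "x \<oplus>\<^bsub>P_obj A\<^esub> \<sim>\<^bsub>P_obj A\<^esub> \<zero>\<^bsub>P_obj A\<^esub> = \<sim>\<^bsub>P_obj A\<^esub> \<zero>\<^bsub>P_obj A\<^esub>"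
    by simp_all
  show "\<sim>\<^bsub>P_obj A\<^esub> x \<in> carrier (P_obj A)"
    using x by (auto simp: P_carrier)
  assume y: "y \<in> carrier (P_obj A)"
  then have yA: "y \<in> carrier A"
    by (simp add: P_carrier)
  show "x \<oplus>\<^bsub>P_obj A\<^esub> y \<in> carrier (P_obj A)"
    using P_oplus_closed[OF x y] by simp
  show "x \<oplus>\<^bsub>P_obj A\<^esub> y = y \<oplus>\<^bsub>P_obj A\<^esub> x"
    "\<sim>\<^bsub>P_obj A\<^esub> (\<sim>\<^bsub>P_obj A\<^esub> x \<oplus>\<^bsub>P_obj A\<^esub> y) \<oplus>\<^bsub>P_obj A\<^esub> y =
      \<sim>\<^bsub>P_obj A\<^esub> (\<sim>\<^bsub>P_obj A\<^esub> y \<oplus>\<^bsub>P_obj A\<^esub> x) \<oplus>\<^bsub>P_obj A\<^esub> x"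
    unfolding P_ops using xA yA by (rule oplus_comm lukasiewicz)+
  assume "z \<in> carrier (P_obj A)"
  then have "z \<in> carrier A"
    by (simp add: P_carrier)
  with xA yA show "(x \<oplus>\<^bsub>P_obj A\<^esub> y) \<oplus>\<^bsub>P_obj A\<^esub> z = x \<oplus>\<^bsub>P_obj A\<^esub> (y \<oplus>\<^bsub>P_obj A\<^esub> z)"
    by (simp add: oplus_assoc)
qed

end

section \<open>Homomorphisms\<close>

lemma mv_homD:
  assumes "f \<in> mv_hom A B"
  shows "x \<in> carrier A \<Longrightarrow> f x \<in> carrier B"
    and "x \<in> carrier A \<Longrightarrow> y \<in> carrier A \<Longrightarrow> f (x \<oplus>\<^bsub>A\<^esub> y) = f x \<oplus>\<^bsub>B\<^esub> f y"
    and "x \<in> carrier A \<Longrightarrow> f (\<sim>\<^bsub>A\<^esub> x) = \<sim>\<^bsub>B\<^esub> (f x)"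
    and "f \<zero>\<^bsub>A\<^esub> = \<zero>\<^bsub>B\<^esub>"
  using assms by (auto simp: mv_hom_def)

text \<open>The inverse of a bijective morphism preserves the operations: each equation is obtained
  by applying the inverse to the corresponding equation for \<open>h\<close>.\<close>

lemma mv_isomorphism_iff_bij:
  assumes A: "mv_algebra A"
  shows "mv_isomorphism A B h \<longleftrightarrow> h \<in> mv_hom A B \<and> bij_betw h (carrier A) (carrier B)"
proof
  assume "mv_isomorphism A B h"
  then obtain g where "h \<in> mv_hom A B" "g \<in> mv_hom B A"
    "\<forall>x\<in>carrier A. g (h x) = x" "\<forall>y\<in>carrier B. h (g y) = y"
    by (auto simp: mv_isomorphism_def)
  then show "h \<in> mv_hom A B \<and> bij_betw h (carrier A) (carrier B)"
    by (auto simp: mv_homD intro!: bij_betw_byWitness[of _ g])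
next
  interpret A: mv_algebra A by fact
  assume h: "h \<in> mv_hom A B \<and> bij_betw h (carrier A) (carrier B)"
  let ?g = "inv_into (carrier A) h"
  have inv: "?g (h x) = x" if "x \<in> carrier A" for x
    using h that bij_betw_inv_into_left by metis
  have surj: "h (?g y) = y" if "y \<in> carrier B" for y
    using h that bij_betw_inv_into_right by metis
  have mem: "?g y \<in> carrier A" if "y \<in> carrier B" for y
    using h that bij_betw_imp_surj_on inv_into_into by metis
  have "?g \<in> mv_hom B A"
    unfolding mv_hom_def
  proof (intro CollectI conjI ballI)
    show "?g \<in> carrier B \<rightarrow> carrier A"
      using mem by blast
    show "?g (x \<oplus>\<^bsub>B\<^esub> y) = ?g x \<oplus>\<^bsub>A\<^esub> ?g y" if "x \<in> carrier B" "y \<in> carrier B" for x y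
      using that h mv_homD(2)[of h A B "?g x" "?g y"] inv[of "?g x \<oplus>\<^bsub>A\<^esub> ?g y"]
      by (simp add: surj mem)
    show "?g (\<sim>\<^bsub>B\<^esub> x) = \<sim>\<^bsub>A\<^esub> (?g x)" if "x \<in> carrier B" for x
      using that h mv_homD(3)[of h A B "?g x"] inv[of "\<sim>\<^bsub>A\<^esub> (?g x)"]
      by (simp add: surj mem)
    show "?g \<zero>\<^bsub>B\<^esub> = \<zero>\<^bsub>A\<^esub>"
      using h mv_homD(4)[of h A B] inv[of "\<zero>\<^bsub>A\<^esub>"] by simp
  qed
  then show "mv_isomorphism A B h"
    using h inv surj by (auto simp: mv_isomorphism_def)
qed

section \<open>Pullbacks as fibre products\<close>

lemma mv_algebra_fibre_product:
  assumes "mv_algebra X" "mv_algebra Y" "g \<in> mv_hom X Z" "h \<in> mv_hom Y Z"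
  shows "mv_algebra \<lparr>carrier = {(x, y). x \<in> carrier X \<and> y \<in> carrier Y \<and> g x = h y},
    oplus = (\<lambda>(x, y) (x', y'). (x \<oplus>\<^bsub>X\<^esub> x', y \<oplus>\<^bsub>Y\<^esub> y')),
    neg = (\<lambda>(x, y). (\<sim>\<^bsub>X\<^esub> x, \<sim>\<^bsub>Y\<^esub> y)), zero = (\<zero>\<^bsub>X\<^esub>, \<zero>\<^bsub>Y\<^esub>)\<rparr>"
proof -
  interpret X: mv_algebra X by fact
  interpret Y: mv_algebra Y by fact
  show ?thesis
    by unfold_locales
      (auto simp: mv_homD[OF assms(3)] mv_homD[OF assms(4)]
        intro: X.oplus_assoc Y.oplus_assoc X.oplus_comm Y.oplus_comm X.lukasiewicz Y.lukasiewicz)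
qed

text \<open>The right side says that the comparison map from \<open>P\<close> to the fibre product
  is bijective. If the square is a pullback, testing it on the fibre product gives a map
  \<open>s\<close> back, and testing it on \<open>P\<close> shows that \<open>s\<close> is a
  retraction. Conversely, the unique elements form the mediating morphism.\<close>

lemma mv_pullback_iff:
  fixes P :: "'p mv" and X :: "'x mv" and Y :: "'y mv"
  assumes alg: "mv_algebra P" "mv_algebra X" "mv_algebra Y" "mv_algebra Z"
    and homs: "p1 \<in> mv_hom P X" "p2 \<in> mv_hom P Y" "g \<in> mv_hom X Z" "h \<in> mv_hom Y Z"
    and comm: "\<And>a. a \<in> carrier P \<Longrightarrow> g (p1 a) = h (p2 a)"
  shows "mv_pullback P X Y Z p1 p2 g h \<longleftrightarrow>
    (\<forall>x\<in>carrier X. \<forall>y\<in>carrier Y. g x = h y \<longrightarrow> (\<exists>!a. a \<in> carrier P \<and> p1 a = x \<and> p2 a = y))"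
    (is "_ \<longleftrightarrow> ?R")
proof
  assume pb: "mv_pullback P X Y Z p1 p2 g h"
  let ?F = "\<lparr>carrier = {(x, y). x \<in> carrier X \<and> y \<in> carrier Y \<and> g x = h y},
    oplus = (\<lambda>(x, y) (x', y'). (x \<oplus>\<^bsub>X\<^esub> x', y \<oplus>\<^bsub>Y\<^esub> y')),
    neg = (\<lambda>(x, y). (\<sim>\<^bsub>X\<^esub> x, \<sim>\<^bsub>Y\<^esub> y)), zero = (\<zero>\<^bsub>X\<^esub>, \<zero>\<^bsub>Y\<^esub>)\<rparr>"
  have "fst \<in> mv_hom ?F X" "snd \<in> mv_hom ?F Y" "\<forall>c\<in>carrier ?F. g (fst c) = h (snd c)"
    by (auto simp: mv_hom_def)
  with mv_pullback_universal[OF pb, where ?'c = "'x \<times> 'y", unfolded mv_pullback_wrt_def]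
    mv_algebra_fibre_product[OF alg(2,3) homs(3,4)]
  obtain s where s: "s \<in> mv_hom ?F P" "\<forall>c\<in>carrier ?F. p1 (s c) = fst c \<and> p2 (s c) = snd c"
    by blast
  have into_F: "(\<lambda>a. (p1 a, p2 a)) \<in> mv_hom P ?F"
    using homs comm by (auto simp: mv_hom_def Pi_iff)
  have id: "(\<lambda>a. a) \<in> mv_hom P P"
    by (auto simp: mv_hom_def)
  \<comment> \<open>The identity and the comparison map followed by \<open>s\<close> are both
    endomorphisms of \<open>P\<close> compatible with the projections, so both coincide with
    \<open>u\<close>.\<close>
  obtain u where u: "\<forall>v\<in>mv_hom P P. (\<forall>c\<in>carrier P. p1 (v c) = p1 c \<and> p2 (v c) = p2 c) \<longrightarrow>
      (\<forall>c\<in>carrier P. v c = u c)"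
    using mv_pullback_universal[OF pb, where ?'c = 'p, unfolded mv_pullback_wrt_def]
      alg(1) homs(1,2) comm by blast
  have retr: "s (p1 a, p2 a) = a" if a: "a \<in> carrier P" for a
  proof -
    have "\<forall>c\<in>carrier P. p1 (s (p1 c, p2 c)) = p1 c \<and> p2 (s (p1 c, p2 c)) = p2 c"
      using s(2) mv_homD(1)[OF into_F] by simp
    then have "s (p1 a, p2 a) = u a"
      using bspec[OF u mv_hom_comp[OF into_F s(1)]] a by blast
    moreover have "a = u a"
      using bspec[OF u id] a by blast
    ultimately show ?thesis by simp
  qed
  show ?R
  proof (intro ballI impI)
    fix x y assume xy: "x \<in> carrier X" "y \<in> carrier Y" "g x = h y"
    then have "(x, y) \<in> carrier ?F" by simp
    then show "\<exists>!a. a \<in> carrier P \<and> p1 a = x \<and> p2 a = y"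
      using s retr mv_homD(1)[OF s(1)] by (intro ex1I[of _ "s (x, y)"]) auto
  qed
next
  assume R: ?R
  interpret P: mv_algebra P by fact
  define s where "s x y = (THE a. a \<in> carrier P \<and> p1 a = x \<and> p2 a = y)" for x y
  have s: "s x y \<in> carrier P \<and> p1 (s x y) = x \<and> p2 (s x y) = y"
    if "x \<in> carrier X" "y \<in> carrier Y" "g x = h y" for x y
    unfolding s_def by (rule theI') (use R that in blast)
  have s_eq: "s (p1 a) (p2 a) = a" if "a \<in> carrier P" for a
    using R s[of "p1 a" "p2 a"] that comm mv_homD(1)[OF homs(1)] mv_homD(1)[OF homs(2)] by metis
  have "\<exists>u\<in>mv_hom Q P.
           (\<forall>c\<in>carrier Q. p1 (u c) = q1 c \<and> p2 (u c) = q2 c) \<and>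
           (\<forall>v\<in>mv_hom Q P.
              (\<forall>c\<in>carrier Q. p1 (v c) = q1 c \<and> p2 (v c) = q2 c) \<longrightarrow>
              (\<forall>c\<in>carrier Q. v c = u c))"
    if Q: "mv_algebra Q" and q: "q1 \<in> mv_hom Q X" "q2 \<in> mv_hom Q Y"
      "\<forall>c\<in>carrier Q. g (q1 c) = h (q2 c)"
    for Q :: "('p \<times> 'x \<times> 'y) mv" and q1 q2
  proof -
    interpret Q: mv_algebra Q by fact
    let ?u = "\<lambda>c. s (q1 c) (q2 c)"
    have u: "?u c \<in> carrier P" "p1 (?u c) = q1 c" "p2 (?u c) = q2 c" if "c \<in> carrier Q" for c
      using s q that mv_homD(1)[OF q(1)] mv_homD(1)[OF q(2)] by auto
    \<comment> \<open>An element is determined by its two projections. Preservation of the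
      operations by \<open>?u\<close> is thus checked after applying \<open>p1\<close> and
      \<open>p2\<close>.\<close>
    have uniq: "?u c = a" if "c \<in> carrier Q" "a \<in> carrier P" "p1 a = q1 c" "p2 a = q2 c" for c a
      using s_eq[OF that(2)] that by simp
    have u_hom: "?u \<in> mv_hom Q P"
      unfolding mv_hom_def
    proof (intro CollectI conjI ballI)
      show "?u \<in> carrier Q \<rightarrow> carrier P"
        using u by blast
    qed (rule uniq; simp add: u mv_homD[OF homs(1)] mv_homD[OF homs(2)]
          mv_homD[OF q(1)] mv_homD[OF q(2)])+
    have v: "v c = ?u c"
      if "v \<in> mv_hom Q P" "\<forall>c\<in>carrier Q. p1 (v c) = q1 c \<and> p2 (v c) = q2 c"
        "c \<in> carrier Q" for v c
      using uniq[OF that(3) mv_homD(1)[OF that(1,3)]] that(2,3) by simp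
    show ?thesis
    proof (rule bexI[OF _ u_hom], intro conjI ballI impI)
      show "v c = ?u c" if "v \<in> mv_hom Q P"
        "\<forall>c\<in>carrier Q. p1 (v c) = q1 c \<and> p2 (v c) = q2 c" "c \<in> carrier Q" for v c
        using that by (rule v)
    qed (use u in simp_all)
  qed
  then show "mv_pullback P X Y Z p1 p2 g h"
    unfolding mv_pullback_def mv_pullback_wrt_def using alg homs comm by blast
qed

section \<open>Morphisms, maximal ideals and the radical\<close>

locale mv_morphism = A: mv_algebra A + B: mv_algebra B
  for A :: "'a mv" and B :: "'b mv" +
  fixes f :: "'a \<Rightarrow> 'b"
  assumes hom: "f \<in> mv_hom A B"
begin

lemmas f_closed [simp, intro] = mv_homD(1)[OF hom]
lemmas f_oplus [simp] = mv_homD(2)[OF hom]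
lemmas f_neg [simp] = mv_homD(3)[OF hom]
lemmas f_zero [simp] = mv_homD(4)[OF hom]

lemma f_one [simp]: "f \<one>\<^bsub>A\<^esub> = \<one>\<^bsub>B\<^esub>"
  using f_neg[of "\<zero>\<^bsub>A\<^esub>"] by simp

lemma f_minus [simp]:
  "x \<in> carrier A \<Longrightarrow> y \<in> carrier A \<Longrightarrow> f (x \<ominus>\<^bsub>A\<^esub> y) = f x \<ominus>\<^bsub>B\<^esub> f y"
  by (simp add: mv_minus_def)

lemma f_dist:
  "x \<in> carrier A \<Longrightarrow> y \<in> carrier A \<Longrightarrow> f (mv_dist A x y) = mv_dist B (f x) (f y)"
  by (simp add: mv_dist_def)

lemma f_mult: "x \<in> carrier A \<Longrightarrow> f (A.mult n x) = B.mult n (f x)"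
  by (induction n) auto

lemma f_le: "x \<in> carrier A \<Longrightarrow> y \<in> carrier A \<Longrightarrow> x \<sqsubseteq>\<^bsub>A\<^esub> y \<Longrightarrow> f x \<sqsubseteq>\<^bsub>B\<^esub> f y"
  by (auto simp: A.le_iff_oplus)

text \<open>Holds for any morphism, surjective or not: \<open>f\<close> commutes with negation and
  multiples, so the archimedean criterion for \<open>f x\<close> and \<open>M\<close> is the one for
  \<open>x\<close> and the preimage.\<close>

lemma maximal_ideal_vimage:
  assumes M: "mv_maximal_ideal B M"
  shows "mv_maximal_ideal A {x \<in> carrier A. f x \<in> M}"
proof -
  have I: "mv_ideal B M" "\<one>\<^bsub>B\<^esub> \<notin> M"
    using M B.ideal_eq_carrier_iff by (auto simp: mv_maximal_ideal_def)
  show ?thesis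
  proof (rule A.maximal_idealI)
    show "mv_ideal A {x \<in> carrier A. f x \<in> M}"
      unfolding mv_ideal_def
      by (auto intro: B.idealD(2,3)[OF I(1)] B.idealD(4)[OF I(1)] f_le)
    show "\<exists>n. \<sim>\<^bsub>A\<^esub> (A.mult n x) \<in> {x \<in> carrier A. f x \<in> M}"
      if "x \<in> carrier A" "x \<notin> {x \<in> carrier A. f x \<in> M}" for x
      using that B.maximal_ideal_archimedean[OF M, of "f x"] by (auto simp: f_mult)
  qed (use I in simp)
qed

text \<open>An element of \<open>Rad A\<close> lies in the preimage of each maximal ideal of
  \<open>B\<close>, since that preimage is maximal.\<close>

lemma f_Rad: "x \<in> Rad A \<Longrightarrow> f x \<in> Rad B"
  using maximal_ideal_vimage by (auto simp: Rad_def)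

lemma P_map_hom: "P_map A f \<in> mv_hom (P_obj A) (P_obj B)"
proof -
  interpret PA: mv_algebra "P_obj A" by (rule A.mv_algebra_P)
  have "f x \<in> carrier (P_obj B)" if "x \<in> carrier (P_obj A)" for x
    using that f_Rad[of x] f_Rad[of "\<sim>\<^bsub>A\<^esub> x"] by (auto simp: A.P_carrier B.P_carrier)
  moreover have "x \<in> carrier A" if "x \<in> carrier (P_obj A)" for x
    using that by (simp add: A.P_carrier)
  ultimately show ?thesis
    using PA.oplus_closed PA.neg_closed PA.zero_closed
    by (auto simp: mv_hom_def P_map_def)
qed

end

section \<open>The reflection S and its unit\<close>

context mv_algebra
begin

lemma eta_eq_iff:
  "x \<in> carrier A \<Longrightarrow> y \<in> carrier A \<Longrightarrow> eta A x = eta A y \<longleftrightarrow> mv_dist A x y \<in> Rad A"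
  unfolding eta_def by (rule cong_class_eq_iff[OF ideal_Rad])

lemma mv_algebra_S: "mv_algebra (S_obj A)"
  unfolding S_obj_def by (rule mv_algebra_quotient[OF ideal_Rad])

lemma S_carrier: "carrier (S_obj A) = eta A ` carrier A"
  by (simp add: S_obj_def quotient_carrier eta_def)

lemma S_oplus: "x \<in> carrier A \<Longrightarrow> y \<in> carrier A \<Longrightarrow> eta A x \<oplus>\<^bsub>S_obj A\<^esub> eta A y = eta A (x \<oplus> y)"
  and S_neg: "x \<in> carrier A \<Longrightarrow> \<sim>\<^bsub>S_obj A\<^esub> (eta A x) = eta A (\<sim> x)"
  and S_zero: "\<zero>\<^bsub>S_obj A\<^esub> = eta A \<zero>"
  by (simp_all add: S_obj_def eta_def quotient_oplus[OF ideal_Rad] quotient_neg[OF ideal_Rad]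
      quotient_zero)

lemma eta_hom: "eta A \<in> mv_hom A (S_obj A)"
  by (simp add: mv_hom_def S_carrier S_oplus S_neg S_zero)

end

context mv_morphism
begin

text \<open>Since \<open>f\<close> preserves distances and radicals, all members of the class of
  \<open>a\<close> have images in one class. The union over the class is that class because
  \<open>a\<close> itself is a member.\<close>

lemma S_map_eta:
  assumes a: "a \<in> carrier A"
  shows "S_map B f (eta A a) = eta B (f a)"
proof -
  have "eta B (f b) = eta B (f a)" if "b \<in> eta A a" for b
  proof -
    have "b \<in> carrier A" "mv_dist A a b \<in> Rad A"
      using that by (auto simp: eta_def mv_cong_def)
    then show ?thesis
      using a B.eta_eq_iff[of "f a" "f b"] f_Rad[of "mv_dist A a b"] f_dist[of a b] by simp
  qed
  moreover have "a \<in> eta A a"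
    using a A.idealD(2)[OF A.ideal_Rad] by (simp add: eta_def mv_cong_def mv_dist_def)
  ultimately show ?thesis
    unfolding S_map_def by blast
qed

lemma S_map_hom: "S_map B f \<in> mv_hom (S_obj A) (S_obj B)"
  by (auto simp: mv_hom_def A.S_carrier B.S_carrier S_map_eta A.S_oplus B.S_oplus
      A.S_neg B.S_neg A.S_zero B.S_zero)

text \<open>Elements of S(A) are replaced by representatives, which turns the elementwise pullback
  criterion into a statement without quotients.\<close>

lemma trivial_extension_iff:
  "trivial_extension A B f \<longleftrightarrow>
    (\<forall>a\<in>carrier A. \<forall>b\<in>carrier B. mv_dist B (f a) b \<in> Rad B \<longrightarrow>
      (\<exists>!a'. a' \<in> carrier A \<and> mv_dist A a' a \<in> Rad A \<and> f a' = b))"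
proof -
  have "trivial_extension A B f \<longleftrightarrow>
    (\<forall>x\<in>carrier (S_obj A). \<forall>b\<in>carrier B. S_map B f x = eta B b \<longrightarrow>
      (\<exists>!a'. a' \<in> carrier A \<and> eta A a' = x \<and> f a' = b))"
    unfolding trivial_extension_def
    by (intro mv_pullback_iff A.mv_algebra_S B.mv_algebra_S A.mv_algebra_axioms
        B.mv_algebra_axioms A.eta_hom B.eta_hom S_map_hom hom S_map_eta)
  also have "\<dots> \<longleftrightarrow> (\<forall>a\<in>carrier A. \<forall>b\<in>carrier B. eta B (f a) = eta B b \<longrightarrow>
      (\<exists>!a'. a' \<in> carrier A \<and> eta A a' = eta A a \<and> f a' = b))"
    by (simp add: A.S_carrier S_map_eta)
  also have "\<dots> \<longleftrightarrow> (\<forall>a\<in>carrier A. \<forall>b\<in>carrier B. mv_dist B (f a) b \<in> Rad B \<longrightarrow>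
      (\<exists>!a'. a' \<in> carrier A \<and> mv_dist A a' a \<in> Rad A \<and> f a' = b))"
    by (simp add: B.eta_eq_iff A.eta_eq_iff cong: conj_cong)
  finally show ?thesis .
qed

end

section \<open>The characterisation\<close>

text \<open>An isomorphism sends \<open>\<zero>\<close> and \<open>\<one>\<close> to the two truth
  values. A radical element differs from \<open>\<one>\<close>, so it has the same image as
  \<open>\<zero>\<close>. Conversely P(A) consists of \<open>\<zero>\<close> and
  \<open>\<one>\<close>, and the test for \<open>\<one>\<close> is an isomorphism.\<close>

lemma (in mv_algebra) P_initial_iff:
  "P_obj A \<cong> mv_initial \<longleftrightarrow> \<one> \<noteq> \<zero> \<and> Rad A = {\<zero>}"
proof
  assume "P_obj A \<cong> mv_initial"
  then obtain h where h: "h \<in> mv_hom (P_obj A) mv_initial"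
    and bij: "bij_betw h (carrier (P_obj A)) (UNIV :: bool set)"
    using mv_isomorphism_iff_bij[OF mv_algebra_P, of mv_initial]
    by (auto simp: mv_isomorphic_def mv_initial_def)
  have P: "\<zero> \<in> carrier (P_obj A)" "\<one> \<in> carrier (P_obj A)"
    using idealD(2)[OF ideal_Rad] by (auto simp: P_carrier)
  have h01: "\<not> h \<zero>" "h \<one>"
    using mv_homD(3)[OF h P(1)] mv_homD(4)[OF h] by (simp_all add: mv_initial_def)
  then have nt: "\<one> \<noteq> \<zero>" by auto
  moreover have "x = \<zero>" if x: "x \<in> Rad A" for x
  proof -
    have xP: "x \<in> carrier (P_obj A)"
      using x idealD(1)[OF ideal_Rad] by (simp add: P_carrier)
    have "x \<noteq> \<one>"
      using x nt one_in_Rad_iff by blast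
    then have "h x \<noteq> h \<one>"
      using inj_onD[OF bij_betw_imp_inj_on[OF bij] _ xP P(2)] by metis
    then have "h x = h \<zero>"
      using h01 by simp
    then show ?thesis
      by (rule inj_onD[OF bij_betw_imp_inj_on[OF bij] _ xP P(1)])
  qed
  ultimately show "\<one> \<noteq> \<zero> \<and> Rad A = {\<zero>}"
    using idealD(2)[OF ideal_Rad] by blast
next
  assume R: "\<one> \<noteq> \<zero> \<and> Rad A = {\<zero>}"
  have "\<sim> x = \<zero> \<longleftrightarrow> x = \<one>" if "x \<in> carrier A" for x
    using neg_neg[OF that] by (metis neg_one neg_zero)
  then have P: "carrier (P_obj A) = {\<zero>, \<one>}"
    using R by (auto simp: P_carrier)
  have "(\<lambda>x. x = \<one>) \<in> mv_hom (P_obj A) mv_initial"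
    unfolding mv_hom_def P P_ops mv_initial_def
    using R[THEN conjunct1, THEN not_sym] by (simp add: Pi_iff)
  moreover have "bij_betw (\<lambda>x. x = \<one>) (carrier (P_obj A)) (carrier mv_initial)"
    unfolding bij_betw_def P mv_initial_def
    using R[THEN conjunct1, THEN not_sym] by (auto simp: UNIV_bool)
  ultimately show "P_obj A \<cong> mv_initial"
    using mv_isomorphism_iff_bij[OF mv_algebra_P] unfolding mv_isomorphic_def by blast
qed

lemma (in mv_algebra) P_terminal_iff: "P_obj A \<cong> mv_terminal \<longleftrightarrow> \<one> = \<zero>"
proof
  assume "P_obj A \<cong> mv_terminal"
  then obtain h :: "'a \<Rightarrow> unit" where "inj_on h (carrier (P_obj A))"
    using mv_isomorphism_iff_bij[OF mv_algebra_P, of mv_terminal]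
    by (auto simp: mv_isomorphic_def bij_betw_def)
  then show "\<one> = \<zero>"
    using idealD(2)[OF ideal_Rad] by (auto simp: inj_on_def P_carrier)
next
  assume "\<one> = \<zero>"
  then have P: "carrier (P_obj A) = {\<zero>}"
    using carrier_trivial_iff idealD(2)[OF ideal_Rad] by (auto simp: P_carrier)
  have "(\<lambda>_. ()) \<in> mv_hom (P_obj A) mv_terminal"
    by (auto simp: mv_hom_def mv_terminal_def)
  moreover have "bij_betw (\<lambda>_. ()) (carrier (P_obj A)) (carrier mv_terminal)"
    by (auto simp: bij_betw_def P mv_terminal_def)
  ultimately show "P_obj A \<cong> mv_terminal"
    using mv_isomorphism_iff_bij[OF mv_algebra_P] unfolding mv_isomorphic_def by blast
qed

context mv_morphism
begin

lemma P_map_isomorphism_iff: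
  "mv_isomorphism (P_obj A) (P_obj B) (P_map A f) \<longleftrightarrow>
    bij_betw f (carrier (P_obj A)) (carrier (P_obj B))"
proof -
  have "bij_betw (P_map A f) (carrier (P_obj A)) (carrier (P_obj B)) \<longleftrightarrow>
      bij_betw f (carrier (P_obj A)) (carrier (P_obj B))"
    by (rule bij_betw_cong) (simp add: P_map_def)
  then show ?thesis
    using mv_isomorphism_iff_bij[OF A.mv_algebra_P] P_map_hom by metis
qed

text \<open>A trivial kernel on \<open>Rad A\<close> suffices for uniqueness, because two lifts of
  the same pair differ by elements of \<open>Rad A\<close> that \<open>f\<close> sends to
  zero.\<close>

lemma trivial_extensionI:
  assumes inj: "\<And>x. x \<in> Rad A \<Longrightarrow> f x = \<zero>\<^bsub>B\<^esub> \<Longrightarrow> x = \<zero>\<^bsub>A\<^esub>"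
    and surj: "\<And>y. y \<in> Rad B \<Longrightarrow> \<exists>x\<in>Rad A. f x = y"
  shows "trivial_extension A B f"
  unfolding trivial_extension_iff
proof (intro ballI impI)
  fix a b
  assume a: "a \<in> carrier A" and b: "b \<in> carrier B" and d: "mv_dist B (f a) b \<in> Rad B"
  then obtain r s where rs: "r \<in> Rad A" "f r = b \<ominus>\<^bsub>B\<^esub> f a" "s \<in> Rad A" "f s = f a \<ominus>\<^bsub>B\<^esub> b"
    using surj B.ideal_dist_iff[OF B.ideal_Rad] f_closed by metis
  then have c: "r \<in> carrier A" "s \<in> carrier A"
    using A.idealD(1)[OF A.ideal_Rad] by auto
  let ?a = "(a \<ominus>\<^bsub>A\<^esub> s) \<oplus>\<^bsub>A\<^esub> r"
  \<comment> \<open>The candidate exceeds \<open>a\<close> by at most \<open>r\<close> and falls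
    short of it by at most \<open>s\<close>; both errors are radical, so it is congruent to
    \<open>a\<close>.\<close>
  have "?a \<sqsubseteq>\<^bsub>A\<^esub> a \<oplus>\<^bsub>A\<^esub> r"
    using a c by (intro A.oplus_mono A.minus_le) auto
  moreover have "a \<sqsubseteq>\<^bsub>A\<^esub> ?a \<oplus>\<^bsub>A\<^esub> s"
  proof -
    have 1: "a \<sqsubseteq>\<^bsub>A\<^esub> s \<oplus>\<^bsub>A\<^esub> (a \<ominus>\<^bsub>A\<^esub> s)"
      using a c by (simp add: A.le_minus_oplus)
    have 2: "s \<oplus>\<^bsub>A\<^esub> (a \<ominus>\<^bsub>A\<^esub> s) \<sqsubseteq>\<^bsub>A\<^esub> (s \<oplus>\<^bsub>A\<^esub> (a \<ominus>\<^bsub>A\<^esub> s)) \<oplus>\<^bsub>A\<^esub> r"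
      using a c by simp
    have "a \<sqsubseteq>\<^bsub>A\<^esub> (s \<oplus>\<^bsub>A\<^esub> (a \<ominus>\<^bsub>A\<^esub> s)) \<oplus>\<^bsub>A\<^esub> r"
      by (rule A.le_trans[OF _ _ _ 1 2]) (use a c in simp_all)
    then show ?thesis
      using a c by (simp add: A.oplus_ac)
  qed
  ultimately have "(?a, a) \<in> mv_cong A (Rad A)"
    unfolding A.cong_iff[OF A.ideal_Rad] using rs a c by auto
  then have "mv_dist A ?a a \<in> Rad A"
    by (simp add: mv_cong_def)
  \<comment> \<open>The image is the meet of \<open>f a\<close> and \<open>b\<close> plus
    \<open>b \<ominus> f a\<close>, which is \<open>b\<close>.\<close>
  moreover have "f ?a = b"
    using a b c rs B.minus_minus_oplus by simp
  moreover have "x = y" if x: "x \<in> carrier A" "mv_dist A x a \<in> Rad A" "f x = b"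
    and y: "y \<in> carrier A" "mv_dist A y a \<in> Rad A" "f y = b" for x y
  proof -
    have "eta A x = eta A y"
      using x y a A.eta_eq_iff by metis
    then have "mv_dist A x y \<in> Rad A"
      using x y A.eta_eq_iff by simp
    then have "x \<ominus>\<^bsub>A\<^esub> y \<in> Rad A" "y \<ominus>\<^bsub>A\<^esub> x \<in> Rad A"
      using x y A.ideal_dist_iff[OF A.ideal_Rad] by auto
    then show ?thesis
      using x y b inj[of "x \<ominus>\<^bsub>A\<^esub> y"] inj[of "y \<ominus>\<^bsub>A\<^esub> x"]
      by (intro A.le_antisym[of x y] A.minus_eq_zero_imp_le) simp_all
  qed
  ultimately show "\<exists>!a'. a' \<in> carrier A \<and> mv_dist A a' a \<in> Rad A \<and> f a' = b"
    using a c by blast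
qed

lemma trivial_extensionD:
  assumes "trivial_extension A B f"
  shows "bij_betw f (Rad A) (Rad B)"
proof -
  \<comment> \<open>The distance from \<open>x\<close> to zero is \<open>x\<close>, so the lifts of
    a pair \<open>(\<zero>, y)\<close> are exactly the preimages of \<open>y\<close> in
    \<open>Rad A\<close>.\<close>
  have RA: "x \<in> Rad A \<longleftrightarrow> x \<in> carrier A \<and> mv_dist A x \<zero>\<^bsub>A\<^esub> \<in> Rad A" for x
    using A.idealD(1)[OF A.ideal_Rad] by (auto simp: mv_dist_def)
  have ex1: "\<exists>!x. x \<in> Rad A \<and> f x = y" if "y \<in> Rad B" for y
    using assms[unfolded trivial_extension_iff] that A.zero_closed B.idealD(1)[OF B.ideal_Rad that]
    by (subst RA) auto
  then show ?thesis
    unfolding bij_betw_def inj_on_def using f_Rad by blast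
qed

text \<open>Negation carries bijectivity from the radicals to their negations. Nontriviality of
  \<open>B\<close> keeps the images of the two halves apart.\<close>

lemma P_map_bij:
  assumes bij: "bij_betw f (Rad A) (Rad B)" and nt: "\<one>\<^bsub>B\<^esub> \<noteq> \<zero>\<^bsub>B\<^esub>"
  shows "bij_betw f (carrier (P_obj A)) (carrier (P_obj B))"
  unfolding bij_betw_def
proof
  have inj: "x = y" if "x \<in> Rad A" "y \<in> Rad A" "f x = f y" for x y
    using bij that by (auto simp: bij_betw_def inj_on_def)
  have neg_inj: "x = y" if "x \<in> carrier A" "y \<in> carrier A" "\<sim>\<^bsub>A\<^esub> x = \<sim>\<^bsub>A\<^esub> y" for x y
    using that A.neg_neg by metis
  have disj: "f x \<noteq> f y" if "x \<in> Rad A" "y \<in> carrier A" "\<sim>\<^bsub>A\<^esub> y \<in> Rad A" for x y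
    using B.Rad_inter_neg_Rad[of "f x"] f_Rad[of x] f_Rad[of "\<sim>\<^bsub>A\<^esub> y"] nt that by auto
  show "inj_on f (carrier (P_obj A))"
  proof (rule inj_onI)
    fix x y assume "x \<in> carrier (P_obj A)" "y \<in> carrier (P_obj A)" and eq: "f x = f y"
    then consider "x \<in> Rad A" "y \<in> Rad A" | "x \<in> carrier A" "y \<in> carrier A"
      "\<sim>\<^bsub>A\<^esub> x \<in> Rad A" "\<sim>\<^bsub>A\<^esub> y \<in> Rad A"
      using disj[of x y] disj[of y x] by (auto simp: A.P_carrier)
    then show "x = y"
    proof cases
      case 1
      then show ?thesis using inj eq by blast
    next
      case 2
      then have "\<sim>\<^bsub>A\<^esub> x = \<sim>\<^bsub>A\<^esub> y"
        using eq by (intro inj) simp_all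
      with 2 show ?thesis using neg_inj by blast
    qed
  qed
  have surj: "\<exists>x\<in>Rad A. f x = y" if "y \<in> Rad B" for y
    using bij_betw_imp_surj_on[OF bij] that by (metis imageE)
  show "f ` carrier (P_obj A) = carrier (P_obj B)"
  proof
    show "f ` carrier (P_obj A) \<subseteq> carrier (P_obj B)"
      using mv_homD(1)[OF P_map_hom] by (auto simp: P_map_def)
    show "carrier (P_obj B) \<subseteq> f ` carrier (P_obj A)"
    proof
      fix y assume "y \<in> carrier (P_obj B)"
      then consider "y \<in> Rad B" | "y \<in> carrier B" "\<sim>\<^bsub>B\<^esub> y \<in> Rad B"
        by (auto simp: B.P_carrier)
      then show "y \<in> f ` carrier (P_obj A)"
      proof cases
        case 1
        with surj A.idealD(1)[OF A.ideal_Rad] show ?thesis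
          by (force simp: A.P_carrier)
      next
        case 2
        then obtain x where x: "x \<in> Rad A" "f x = \<sim>\<^bsub>B\<^esub> y"
          using surj by blast
        then have "x \<in> carrier A"
          using A.idealD(1)[OF A.ideal_Rad] by blast
        with x 2 show ?thesis
          by (intro image_eqI[of _ _ "\<sim>\<^bsub>A\<^esub> x"]) (auto simp: A.P_carrier)
      qed
    qed
  qed
qed

text \<open>The point is that a preimage \<open>x\<close> of a radical element is radical. If it lay
  only in the negated half, its image would lie in both halves, so \<open>B\<close> would be trivial
  and \<open>f\<close> constant; injectivity would then give \<open>x = \<zero>\<close>, which is
  radical.\<close>

lemma bij_Rad_of_P_map:
  assumes bij: "bij_betw f (carrier (P_obj A)) (carrier (P_obj B))"
  shows "bij_betw f (Rad A) (Rad B)"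
proof -
  have sub: "Rad A \<subseteq> carrier (P_obj A)" "Rad B \<subseteq> carrier (P_obj B)"
    using A.idealD(1)[OF A.ideal_Rad] B.idealD(1)[OF B.ideal_Rad]
    by (auto simp: A.P_carrier B.P_carrier)
  have "\<exists>x\<in>Rad A. f x = y" if y: "y \<in> Rad B" for y
  proof -
    obtain x where x: "x \<in> carrier (P_obj A)" "f x = y"
      using bij_betw_imp_surj_on[OF bij] y sub(2) by (metis imageE subsetD)
    have "x \<in> Rad A"
    proof (rule ccontr)
      assume "x \<notin> Rad A"
      then have nx: "x \<in> carrier A" "\<sim>\<^bsub>A\<^esub> x \<in> Rad A"
        using x by (auto simp: A.P_carrier)
      then have "\<one>\<^bsub>B\<^esub> = \<zero>\<^bsub>B\<^esub>"
        using y x f_Rad[of "\<sim>\<^bsub>A\<^esub> x"] B.Rad_inter_neg_Rad[of y] by simp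
      then have "f x = f \<zero>\<^bsub>A\<^esub>"
        using B.carrier_trivial_iff f_closed[OF nx(1)] by auto
      moreover have "\<zero>\<^bsub>A\<^esub> \<in> Rad A"
        by (rule A.idealD(2)[OF A.ideal_Rad])
      ultimately have "x = \<zero>\<^bsub>A\<^esub>"
        using inj_onD[OF bij_betw_imp_inj_on[OF bij]] x(1) sub(1) by blast
      then show False
        using \<open>x \<notin> Rad A\<close> \<open>\<zero>\<^bsub>A\<^esub> \<in> Rad A\<close> by simp
    qed
    then show ?thesis
      using x by blast
  qed
  moreover have "inj_on f (Rad A)"
    using bij_betw_imp_inj_on[OF bij] sub(1) by (rule inj_on_subset)
  ultimately show ?thesis
    unfolding bij_betw_def using f_Rad by blast
qed

lemma trivial_extension_iff_bij_Rad:
  "trivial_extension A B f \<longleftrightarrow> bij_betw f (Rad A) (Rad B)"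
proof
  assume bij: "bij_betw f (Rad A) (Rad B)"
  show "trivial_extension A B f"
  proof (rule trivial_extensionI)
    show "x = \<zero>\<^bsub>A\<^esub>" if "x \<in> Rad A" "f x = \<zero>\<^bsub>B\<^esub>" for x
      using inj_onD[OF bij_betw_imp_inj_on[OF bij], of x "\<zero>\<^bsub>A\<^esub>"] that
        A.idealD(2)[OF A.ideal_Rad] by simp
    show "\<exists>x\<in>Rad A. f x = y" if "y \<in> Rad B" for y
      using bij_betw_imp_surj_on[OF bij] that by (metis imageE)
  qed
qed (rule trivial_extensionD)

text \<open>Here \<open>f\<close> maps \<open>Rad A\<close> to the single element of
  \<open>Rad B\<close>. For nontrivial \<open>A\<close> the resulting condition says that P(A) is
  the initial algebra, which yields the exceptional case.\<close>

lemma bij_Rad_iff_of_trivial_codomain: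
  assumes "\<one>\<^bsub>B\<^esub> = \<zero>\<^bsub>B\<^esub>"
  shows "bij_betw f (Rad A) (Rad B) \<longleftrightarrow> Rad A = {\<zero>\<^bsub>A\<^esub>}"
proof -
  have "f x = \<zero>\<^bsub>B\<^esub>" if "x \<in> Rad A" for x
    using that assms B.carrier_trivial_iff f_closed A.idealD(1)[OF A.ideal_Rad] by blast
  moreover have "Rad B = {\<zero>\<^bsub>B\<^esub>}"
    using assms B.carrier_trivial_iff B.idealD(1,2)[OF B.ideal_Rad] by blast
  ultimately show ?thesis
    using A.idealD(2)[OF A.ideal_Rad] by (auto simp: bij_betw_def inj_on_def)
qed

end

theorem proposition5p9:
  fixes A :: "'a mv" and B :: "'b mv" and f :: "'a \<Rightarrow> 'b"
  assumes "mv_algebra A" and "mv_algebra B" and "f \<in> mv_hom A B"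
  shows "trivial_extension A B f \<longleftrightarrow>
    mv_isomorphism (P_obj A) (P_obj B) (P_map A f) \<or>
    (P_obj A \<cong> mv_initial \<and> P_obj B \<cong> mv_terminal)"
proof -
  interpret mv_morphism A B f
    using assms by (simp add: mv_morphism_def mv_morphism_axioms_def)
  \<comment> \<open>If both algebras are trivial, P(A) is not initial, but each P is then just the
    radical and the first alternative holds.\<close>
  have trivial: "bij_betw f (carrier (P_obj A)) (carrier (P_obj B))"
    if "bij_betw f (Rad A) (Rad B)" "\<one>\<^bsub>B\<^esub> = \<zero>\<^bsub>B\<^esub>" "\<one>\<^bsub>A\<^esub> = \<zero>\<^bsub>A\<^esub>"
  proof -
    have "Rad A = carrier A" "Rad B = carrier B"
      using that A.one_in_Rad_iff B.one_in_Rad_iff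
        A.ideal_eq_carrier_iff[OF A.ideal_Rad] B.ideal_eq_carrier_iff[OF B.ideal_Rad] by blast+
    then have "carrier (P_obj A) = Rad A" "carrier (P_obj B) = Rad B"
      by (auto simp: A.P_carrier B.P_carrier)
    with that show ?thesis by simp
  qed
  \<comment> \<open>Three cases remain: \<open>B\<close> nontrivial, where the radicals and P are
    equivalent; \<open>B\<close> trivial and \<open>A\<close> nontrivial, where P(A) may be initial;
    and both trivial.\<close>
  show ?thesis
    unfolding trivial_extension_iff_bij_Rad P_map_isomorphism_iff
      A.P_initial_iff B.P_terminal_iff
    using trivial P_map_bij bij_Rad_of_P_map bij_Rad_iff_of_trivial_codomain by blast
qed

end
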